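(* Let $N$ be an arbitrary non-negative integer. Let $a$, $b$ and $c$ be complex numbers satisfying $N > \max(-\Re a,-\Re b)$, $\Re c > \Re b$ and $c \notin \mathbb{Z}_{\le 0}$. Define $R_N^{(F)}(z,a,b,c)$ by $$F(a,b;c;z)=\sum_{n=0}^{N-1}\frac{(a)_n (b)_n}{(c)_n\, n!} z^n+R_N^{(F)} (z,a,b,c).$$ Then: (i) If $\Re z\le 0$, then, with the convention $|\arg(-z)|\le \frac{\pi}{2}$, $$\left| R_N^{(F)} (z,a,b,c) \right| \le \left|\frac{ \Gamma (\Re b + N)\Gamma (c + N)\Gamma (\Re c - \Re b)}{ \Gamma (b + N)\Gamma (\Re c + N)\Gamma (c - b)}\right| \left|\frac{(a)_N (b)_N}{(c)_N N!} z^N\right| \max \left(1,e^{(\Im a)\arg (-z)} \right).$$ (ii) If in addition $\Re a<1$, then for all $z\in\mathbb{C}\setminus[1,+\infty)$, $$\left| R_N^{(F)} (z,a,b,c) \right| \le \left|\frac{ \sin (\pi a) }{ \sin (\pi \Re a)}\right| \left| \frac{\Gamma (\Re b)\Gamma (c)\Gamma (\Re c - \Re b)}{\Gamma (b)\Gamma (\Re c)\Gamma (c - b)} \right| \left| \frac{(\Re a)_N (\Re b)_N }{(\Re c)_N N!} z^N\right| \times \begin{cases} 1 & \text{if } \Re z \le 0, \\ \left|\frac{z}{\Im z}\right| & \text{if } 0<\Re z \le | z |^2, \\ \frac{1}{|1-z|} & \text{if } \Re z > | z |^2,\end{cases}$$ where, if $\Re a$ is an integer or $\Re b$ is a non-positive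 integer, the limiting value has to be taken in this bound. (iii) If $z$ is negative, $a,b,c$ are real, $N>\max(-a,-b)$, $c>b$ and $c\notin\mathbb{Z}_{\le 0}$, then $R_N^{(F)}(z,a,b,c)$ does not exceed the first neglected term $\frac{(a)_N (b)_N}{(c)_N N!} z^N$ in absolute value and has the same sign as it.
   Context: $F(a,b;c;z)$ is the Gauss hypergeometric function (principal branch), equal to $\sum_{n\ge0}\frac{(a)_n(b)_n}{(c)_n n!}z^n$ for $|z|<1$ and continued analytically to $\mathbb{C}\setminus[1,+\infty)$. $(a)_n=a(a+1)\cdots(a+n-1)$, $(a)_0=1$, is the Pochhammer symbol. "Limiting value" means: the quotient $(\Re a)_N/\sin(\pi\Re a)$ is replaced by its limit $\lim_{x\to\Re a}(x)_N/\sin(\pi x)$ (up to absolute value) when $\Re a$ is an integer, and $\Gamma(\Re b)(\Re b)_N$ is read as $\Gamma(\Re b+N)$ when $\Re b$ is a non-positive integer; likewise $\Gamma(\Re c)(\Re c)_N$ is read as $\Gamma(\Re c+N)$ if $\Re c$ is a non-positive integer. For $z=0$ one may take $\arg(-z)=0$. *)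

theory Defs
  imports "HOL-Complex_Analysis.Complex_Analysis"
begin

definition hyp2F1_term :: "complex \<Rightarrow> complex \<Rightarrow> complex \<Rightarrow> complex \<Rightarrow> nat \<Rightarrow> complex" where
  "hyp2F1_term a b c z n =
     pochhammer a n * pochhammer b n / (pochhammer c n * fact n) * z ^ n"

definition slit_plane :: "complex set" where
  "slit_plane = - (complex_of_real ` {1..})"

text \<open>The values on the cut \<open>[1, \<infinity>)\<close> are arbitrary. On \<open>slit_plane\<close> the choice is unique, as
  shown by \<open>hyp2F1_eqI\<close> below.\<close>

definition hyp2F1 :: "complex \<Rightarrow> complex \<Rightarrow> complex \<Rightarrow> complex \<Rightarrow> complex" where
  "hyp2F1 a b c = (SOME f. f holomorphic_on slit_plane \<and>
     (\<forall>z. norm z < 1 \<longrightarrow> f z = (\<Sum>n. hyp2F1_term a b c z n)))"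

definition hyp2F1_remainder :: "nat \<Rightarrow> complex \<Rightarrow> complex \<Rightarrow> complex \<Rightarrow> complex \<Rightarrow> complex" where
  "hyp2F1_remainder N z a b c = hyp2F1 a b c z - (\<Sum>n<N. hyp2F1_term a b c z n)"

text \<open>The quotients \<open>(x)\<^sub>N / sin (\<pi> x)\<close> and the products \<open>\<Gamma>(x) (x)\<^sub>N\<close>, with their limiting
  values at the exceptional points.\<close>

definition pochhammer_over_sin :: "real \<Rightarrow> nat \<Rightarrow> real" where
  "pochhammer_over_sin x N =
     (if x \<in> \<int> then Lim (at x) (\<lambda>t. pochhammer t N / sin (pi * t))
      else pochhammer x N / sin (pi * x))"

definition Gamma_pochhammer :: "real \<Rightarrow> nat \<Rightarrow> real" where
  "Gamma_pochhammer x N =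
     (if x \<in> \<int>\<^sub>\<le>\<^sub>0 then Gamma (x + real N) else Gamma x * pochhammer x N)"

lemma open_slit_plane: "open slit_plane"
proof -
  have "complex_of_real ` {1..} = {z. Im z = 0} \<inter> {z. Re z \<ge> 1}"
    by (auto simp: image_iff complex_eq_iff)
  moreover have "closed ({z. Im z = 0} \<inter> {z. Re z \<ge> 1})"
    by (intro closed_Int closed_halfspace_Re_ge closed_Collect_eq continuous_intros)
  ultimately show ?thesis
    unfolding slit_plane_def by (metis open_Compl)
qed

lemma connected_slit_plane: "connected slit_plane"
  unfolding slit_plane_def
  by (intro starlike_imp_connected starlike_slotted_complex_plane_right)

lemma unit_ball_subset_slit_plane: "ball 0 1 \<subseteq> slit_plane"
  by (auto simp: slit_plane_def)

lemma hyp2F1_eqI: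
  assumes f: "f holomorphic_on slit_plane"
    and eq: "\<And>z. norm z < 1 \<Longrightarrow> f z = (\<Sum>n. hyp2F1_term a b c z n)"
    and z: "z \<in> slit_plane"
  shows "hyp2F1 a b c z = f z"
proof -
  let ?P = "\<lambda>f. f holomorphic_on slit_plane \<and>
     (\<forall>z. norm z < 1 \<longrightarrow> f z = (\<Sum>n. hyp2F1_term a b c z n))"
  have "?P (hyp2F1 a b c)"
    unfolding hyp2F1_def by (rule someI[of ?P f]) (use f eq in auto)
  hence g: "hyp2F1 a b c holomorphic_on slit_plane"
    and geq: "\<And>z. norm z < 1 \<Longrightarrow> hyp2F1 a b c z = (\<Sum>n. hyp2F1_term a b c z n)"
    by auto
  have "hyp2F1 a b c z - f z = 0"
  proof (rule analytic_continuation[where f = "\<lambda>z. hyp2F1 a b c z - f z" and U = "ball 0 1" and \<xi> = 0 and S = slit_plane])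
    show "(\<lambda>z. hyp2F1 a b c z - f z) holomorphic_on slit_plane"
      by (intro holomorphic_intros f g)
    show "(0::complex) islimpt ball 0 1"
      by (intro interior_limit_point) auto
    show "(0::complex) \<in> slit_plane"
      using unit_ball_subset_slit_plane by auto
  qed (use z eq geq open_slit_plane connected_slit_plane unit_ball_subset_slit_plane in auto)
  thus ?thesis by simp
qed

end

theory Submission
  imports Defs
begin

text \<open>
  Write \<open>(1 - w)\<^sup>-\<^sup>a = (\<Sum>n<N. (a)\<^sub>n / n! w\<^sup>n) + w\<^sup>N Q(w)\<close> with \<open>Q\<close> holomorphic off the cut. Euler's integral gives
  \<open>R\<^sub>N(z) = \<Gamma>(c) / (\<Gamma>(b) \<Gamma>(c - b)) z\<^sup>N \<integral> t\<^bsup>b+N-1\<^esup> (1 - t)\<^bsup>c-b-1\<^esup> Q(zt) dt\<close>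
  over \<open>(0, 1)\<close>, where splitting off \<open>w\<^sup>N\<close> makes the integral converge for \<open>Re b > -N\<close>. Each
  bound on \<open>Q\<close> along the segment from \<open>0\<close> to \<open>z\<close> therefore becomes a bound on \<open>R\<^sub>N\<close>, up to a
  real Beta function. In the left half plane \<open>Q\<close> is estimated by Taylor's theorem (with the
  Lagrange form of the remainder for the sign in the real case); for \<open>Re a < 1\<close> one uses
  \<open>Q(w) = sin(\<pi> a) / \<pi> \<integral> u\<^bsup>a+N-1\<^esup> (1 - u)\<^sup>-\<^sup>a / (1 - wu) du\<close> and the distance from \<open>1\<close> to the segment.
\<close>

section \<open>The complex Beta integral\<close>

text \<open>By Cauchy's estimate the majorant of \<open>h\<close> also dominates the difference quotients.\<close>

lemma holomorphic_on_integral_dominated: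
  fixes h :: "complex \<Rightarrow> 'a::euclidean_space \<Rightarrow> complex"
  assumes "open U"
    and int: "\<And>z. z \<in> U \<Longrightarrow> h z integrable_on S"
    and hol: "\<And>t. t \<in> S \<Longrightarrow> (\<lambda>z. h z t) holomorphic_on U"
    and dom: "\<And>z. z \<in> U \<Longrightarrow> \<exists>e>0. \<exists>\<psi>. ball z e \<subseteq> U \<and> \<psi> integrable_on S \<and>
                (\<forall>w\<in>ball z e. \<forall>t\<in>S. norm (h w t) \<le> \<psi> t)"
  shows "(\<lambda>z. integral S (h z)) holomorphic_on U"
proof -
  have "\<exists>D. ((\<lambda>z. integral S (h z)) has_field_derivative D) (at z)" if z: "z \<in> U" for z
  proof -
    obtain e \<psi> where e: "e > 0" "ball z e \<subseteq> U" and \<psi>: "\<psi> integrable_on S"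
      and bound: "\<And>w t. w \<in> ball z e \<Longrightarrow> t \<in> S \<Longrightarrow> norm (h w t) \<le> \<psi> t"
      using dom[OF z] by blast
    have deriv_le: "norm (deriv (\<lambda>z. h z t) w) \<le> \<psi> t / (e/4)"
      if t: "t \<in> S" and w: "w \<in> ball z (e/2)" for t w
    proof -
      \<comment> \<open>Since \<open>w\<close> is within \<open>e/2\<close> of \<open>z\<close>, a
        Cauchy circle of radius \<open>e/4\<close> about \<open>w\<close> stays in the disc on which
        \<open>\<psi>\<close> dominates.\<close>
      have sub: "cball w (e/4) \<subseteq> ball z e"
      proof
        fix u assume "u \<in> cball w (e/4)"
        thus "u \<in> ball z e"
          using w e(1) dist_triangle[of z u w] by auto
      qed
      have hw: "(\<lambda>z. h z t) holomorphic_on cball w (e/4)"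
        using hol[OF t] sub e(2) by (meson holomorphic_on_subset order_trans)
      have "norm ((deriv ^^ 1) (\<lambda>z. h z t) w) \<le> fact 1 * \<psi> t / (e/4) ^ 1"
      proof (rule Cauchy_inequality)
        show "(\<lambda>z. h z t) holomorphic_on ball w (e/4)"
          using hw by (meson ball_subset_cball holomorphic_on_subset)
        show "continuous_on (cball w (e/4)) (\<lambda>z. h z t)"
          using hw by (rule holomorphic_on_imp_continuous_on)
        show "norm (h x t) \<le> \<psi> t" if "norm (w - x) = e/4" for x
          by (rule bound[OF subsetD[OF sub] t]) (use that in \<open>simp add: dist_norm\<close>)
      qed (use e in auto)
      thus ?thesis by simp
    qed
    have quot_le: "norm ((h w t - h z t) / (w - z)) \<le> \<psi> t / (e/4)"
      if t: "t \<in> S" and w: "w \<in> ball z (e/2)" "w \<noteq> z" for t w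
    proof -
      have "norm (h w t - h z t) \<le> (\<psi> t / (e/4)) * norm (w - z)"
      proof (rule field_differentiable_bound[of "ball z (e/2)" "\<lambda>z. h z t" "deriv (\<lambda>z. h z t)"])
        fix u assume u: "u \<in> ball z (e/2)"
        hence "u \<in> U" using e by auto
        thus "((\<lambda>z. h z t) has_field_derivative deriv (\<lambda>z. h z t) u) (at u within ball z (e/2))"
          using hol[OF t] \<open>open U\<close> holomorphic_derivI has_field_derivative_at_within by blast
        show "norm (deriv (\<lambda>z. h z t) u) \<le> \<psi> t / (e/4)"
          by (rule deriv_le[OF t u])
      qed (use w e in auto)
      thus ?thesis using w by (simp add: norm_divide divide_le_eq)
    qed
    \<comment> \<open>Dominated convergence concerns sequences, so the limit of the difference
      quotients is tested along an arbitrary sequence \<open>X\<close>.\<close>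
    have "((\<lambda>w. (integral S (h w) - integral S (h z)) / (w - z)) \<longlongrightarrow>
            integral S (\<lambda>t. deriv (\<lambda>z. h z t) z)) (at z within ball z (e/2))"
      unfolding tendsto_at_iff_sequentially
    proof (intro allI impI)
      fix X assume X: "\<forall>i. X i \<in> ball z (e/2) - {z}" "X \<longlonglongrightarrow> z"
      have XU: "X i \<in> U" for i using X(1) e by (auto dest!: spec[of _ i] simp: subset_iff)
      have "(\<lambda>k. integral S (\<lambda>t. (h (X k) t - h z t) / (X k - z))) \<longlonglongrightarrow>
              integral S (\<lambda>t. deriv (\<lambda>z. h z t) z)"
      proof (rule dominated_convergence)
        show "(\<lambda>t. \<psi> t / (e/4)) integrable_on S"
          using integrable_on_cmult_right[OF \<psi>, of "inverse (e/4)"] by (simp add: field_simps)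
        show "(\<lambda>t. (h (X k) t - h z t) / (X k - z)) integrable_on S" for k
          by (intro integrable_on_divide integrable_diff int XU z)
        show "norm ((h (X k) t - h z t) / (X k - z)) \<le> \<psi> t / (e/4)" if "t \<in> S" for k t
          using quot_le[OF that, of "X k"] X(1) by auto
        show "(\<lambda>k. (h (X k) t - h z t) / (X k - z)) \<longlonglongrightarrow> deriv (\<lambda>z. h z t) z" if "t \<in> S" for t
        proof -
          have "((\<lambda>w. (h w t - h z t) / (w - z)) \<longlongrightarrow> deriv (\<lambda>z. h z t) z) (at z)"
            using holomorphic_derivI[OF hol[OF that] \<open>open U\<close> z] by (simp add: has_field_derivative_iff)
          moreover have "filterlim X (at z) sequentially"
            using X by (auto simp: filterlim_at)
          ultimately show ?thesis by (rule filterlim_compose)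
        qed
      qed
      moreover have "integral S (\<lambda>t. (h (X k) t - h z t) / (X k - z)) =
                      (integral S (h (X k)) - integral S (h z)) / (X k - z)" for k
        by (simp add: integral_divide integral_diff[OF int[OF XU[of k]] int[OF z]])
      ultimately show "((\<lambda>w. (integral S (h w) - integral S (h z)) / (w - z)) \<circ> X) \<longlonglongrightarrow>
              integral S (\<lambda>t. deriv (\<lambda>z. h z t) z)"
        unfolding o_def by (simp only:)
    qed
    hence "((\<lambda>z. integral S (h z)) has_field_derivative integral S (\<lambda>t. deriv (\<lambda>z. h z t) z)) (at z)"
      using e at_within_open[of z "ball z (e/2)"] by (simp add: has_field_derivative_iff)
    thus ?thesis by blast
  qed
  thus ?thesis
    using \<open>open U\<close> by (simp add: holomorphic_on_open)
qed

section \<open>The Beta integrand with complex exponents\<close>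

definition beta_kernel :: "complex \<Rightarrow> complex \<Rightarrow> real \<Rightarrow> complex" where
  "beta_kernel p q t = of_real t powr (p - 1) * of_real (1 - t) powr (q - 1)"

lemma norm_beta_kernel:
  assumes "t \<in> {0<..<1}"
  shows "norm (beta_kernel p q t) = t powr (Re p - 1) * (1 - t) powr (Re q - 1)"
  using assms by (simp add: beta_kernel_def norm_mult norm_powr_real_powr del: of_real_diff)

lemma beta_kernel_of_real:
  assumes "t \<in> {0<..<1}"
  shows "beta_kernel (of_real x) (of_real y) t = of_real (t powr (x - 1) * (1 - t) powr (y - 1))"
  using assms powr_of_real[of t "x - 1"] powr_of_real[of "1 - t" "y - 1"]
  by (simp add: beta_kernel_def)

lemma continuous_on_beta_kernel: "continuous_on {0<..<1} (beta_kernel p q)"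
  unfolding beta_kernel_def by (intro continuous_intros) auto

lemma holomorphic_beta_kernel:
  assumes "t \<in> {0<..<1}"
  shows "(\<lambda>p. beta_kernel p q t) holomorphic_on A"
  using assms unfolding beta_kernel_def by (auto intro!: holomorphic_intros simp del: of_real_diff)

lemma has_integral_Beta_Ioo:
  assumes "x > 0" "y > 0"
  shows "((\<lambda>t. t powr (x - 1) * (1 - t) powr (y - 1)) has_integral Beta x y) {0<..<1::real}"
  using has_integral_Beta_real[OF assms] by (simp add: has_integral_Icc_iff_Ioo)

text \<open>The modulus of the kernel is the real Beta integrand, so \<open>M\<close> times that
  integrand is an integrable majorant of the product. Measurability comes from continuity on the
  open interval, which permits blow-up at the ends.\<close>

lemma beta_kernel_mult_bound:
  fixes g :: "real \<Rightarrow> complex"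
  assumes pq: "Re p > 0" "Re q > 0"
    and g: "continuous_on {0<..<1} g" "\<And>t. t \<in> {0<..<1} \<Longrightarrow> norm (g t) \<le> M"
  shows "(\<lambda>t. beta_kernel p q t * g t) integrable_on {0<..<1}"
    and "norm (integral {0<..<1} (\<lambda>t. beta_kernel p q t * g t)) \<le> M * Beta (Re p) (Re q)"
proof -
  let ?\<psi> = "\<lambda>t. M * (t powr (Re p - 1) * (1 - t) powr (Re q - 1))"
  have \<psi>: "(?\<psi> has_integral M * Beta (Re p) (Re q)) {0<..<1}"
    by (intro has_integral_mult_right has_integral_Beta_Ioo pq)
  have le: "norm (beta_kernel p q t * g t) \<le> ?\<psi> t" if "t \<in> {0<..<1}" for t
    using mult_right_mono[OF g(2)[OF that], of "norm (beta_kernel p q t)"]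
    by (simp add: norm_mult norm_beta_kernel[OF that] mult_ac)
  show int: "(\<lambda>t. beta_kernel p q t * g t) integrable_on {0<..<1}"
  proof (rule measurable_bounded_by_integrable_imp_integrable)
    show "(\<lambda>t. beta_kernel p q t * g t) \<in> borel_measurable (lebesgue_on {0<..<1})"
      by (intro continuous_imp_measurable_on_sets_lebesgue continuous_intros continuous_on_beta_kernel g) auto
    show "?\<psi> integrable_on {0<..<1}" using \<psi> by blast
  qed (use le in auto)
  show "norm (integral {0<..<1} (\<lambda>t. beta_kernel p q t * g t)) \<le> M * Beta (Re p) (Re q)"
    using integral_norm_bound_integral[OF int has_integral_integrable[OF \<psi>] le]
    unfolding integral_unique[OF \<psi>] .
qed

lemma integral_beta_kernel_holomorphic:
  assumes q: "Re q > 0"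
  shows "(\<lambda>p. integral {0<..<1} (beta_kernel p q)) holomorphic_on {p. Re p > 0}"
proof (rule holomorphic_on_integral_dominated)
  show "open {p. Re p > 0}" by (rule open_halfspace_Re_gt)
  show "beta_kernel p q integrable_on {0<..<1}" if "p \<in> {p. Re p > 0}" for p
    using beta_kernel_mult_bound(1)[of p q "\<lambda>_. 1" 1] that q by simp
  show "(\<lambda>p. beta_kernel p q t) holomorphic_on {p. Re p > 0}" if "t \<in> {0<..<1}" for t
    using holomorphic_beta_kernel[OF that] by simp
  fix p :: complex assume "p \<in> {p. Re p > 0}"
  hence p: "Re p > 0" by simp
  \<comment> \<open>On this disc all real parts exceed \<open>Re p / 2\<close>, and for
    \<open>0 < t < 1\<close> a power of \<open>t\<close> decreases in its exponent. The real Beta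
    integrand with first parameter \<open>Re p / 2\<close> is thus a majorant for the whole
    disc.\<close>
  have Re: "Re w > Re p / 2" if "w \<in> ball p (Re p / 2)" for w
    using that abs_Re_le_cmod[of "p - w"] by (auto simp: dist_norm)
  show "\<exists>e>0. \<exists>\<psi>. ball p e \<subseteq> {p. Re p > 0} \<and> \<psi> integrable_on {0<..<1} \<and>
                (\<forall>w\<in>ball p e. \<forall>t\<in>{0<..<1}. norm (beta_kernel w q t) \<le> \<psi> t)"
  proof (intro exI conjI ballI)
    show "Re p / 2 > 0" using p by simp
    show "ball p (Re p / 2) \<subseteq> {p. Re p > 0}" using Re p by force
    show "(\<lambda>t. t powr (Re p / 2 - 1) * (1 - t) powr (Re q - 1)) integrable_on {0<..<1}"
      using has_integral_Beta_Ioo[of "Re p / 2" "Re q"] p q by auto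
    fix w t assume "w \<in> ball p (Re p / 2)" "t \<in> {0<..<1::real}"
    thus "norm (beta_kernel w q t) \<le> t powr (Re p / 2 - 1) * (1 - t) powr (Re q - 1)"
      using Re[of w] by (auto simp: norm_beta_kernel intro!: mult_right_mono powr_mono')
  qed
qed

text \<open>The substitution of \<open>1 - t\<close> for \<open>t\<close>, composed of a shift and a
  reflection. It is carried out on the closed interval, whose end points do not change the
  integral.\<close>

lemma integral_beta_kernel_commute:
  "integral {0<..<1} (beta_kernel p q) = integral {0<..<1} (beta_kernel q p)"
proof -
  have "integral {0<..<1} (beta_kernel p q) = integral ({0..1}) (beta_kernel p q)"
    by (simp add: integral_open_interval_real)
  also have "\<dots> = integral {0..1} (\<lambda>t. beta_kernel q p (1 - t))"
    by (intro integral_cong) (simp add: beta_kernel_def mult.commute)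
  also have "\<dots> = integral {0..1} (beta_kernel q p)"
    using integral_shift_real_ivl[of "-1" "-1" 0 "\<lambda>t. beta_kernel q p (- t)"]
      Henstock_Kurzweil_Integration.integral_reflect_real[of 1 0 "beta_kernel q p"]
    by simp
  finally show ?thesis by (simp add: integral_open_interval_real)
qed

text \<open>Identity theorem: the positive reals accumulate at \<open>1\<close>, a point of the
  connected right half plane.\<close>

lemma half_plane_real_continuation:
  assumes "f holomorphic_on {z. Re z > 0}" "g holomorphic_on {z. Re z > 0}"
    and "\<And>x. x > 0 \<Longrightarrow> f (of_real x) = g (of_real x)" and "Re z > 0"
  shows "f z = g z"
proof -
  have "f z - g z = 0"
  proof (rule analytic_continuation[where f = "\<lambda>z. f z - g z" and U = "of_real ` {0<..}" and \<xi> = 1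
        and S = "{z. Re z > 0}"])
    show "(\<lambda>z. f z - g z) holomorphic_on {z. Re z > 0}"
      by (intro holomorphic_intros assms)
    show "connected {z. Re z > 0}"
      by (intro convex_connected convex_halfspace_Re_gt)
    have "(1::real) islimpt {0<..}"
      by (rule interior_limit_point) (auto simp: interior_open)
    hence "of_real 1 islimpt (complex_of_real ` {0<..})"
      by (intro islimpt_isCont_image) (auto simp: eventually_at_filter inj_eq intro!: continuous_intros)
    thus "1 islimpt (complex_of_real ` {0<..})" by simp
  qed (use assms open_halfspace_Re_gt in auto)
  thus ?thesis by simp
qed

text \<open>Analytic continuation from the real Beta integral, one argument at a time.\<close>

lemma integral_beta_kernel:
  assumes "Re p > 0" "Re q > 0"
  shows "integral {0<..<1} (beta_kernel p q) = Beta p q"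
proof -
  have nonpole: "z \<notin> \<int>\<^sub>\<le>\<^sub>0" if "Re z > 0" for z :: complex
    using that by (auto elim!: nonpos_Ints_cases)
  have hol: "(\<lambda>z. Beta z w) holomorphic_on {z. Re z > 0}" if "Re w > 0" for w
    using that unfolding Beta_altdef by (intro holomorphic_intros) (auto intro!: nonpole)
  have real: "integral {0<..<1} (beta_kernel (of_real x) (of_real y)) = Beta (of_real x) (of_real y)"
    if "x > 0" "y > 0" for x y
  proof -
    have "((\<lambda>t. of_real (t powr (x - 1) * (1 - t) powr (y - 1))) has_integral complex_of_real (Beta x y)) {0<..<1}"
      using has_integral_Beta_Ioo[OF that] has_integral_of_real by blast
    also have "?this \<longleftrightarrow> (beta_kernel (of_real x) (of_real y) has_integral complex_of_real (Beta x y)) {0<..<1}"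
      by (intro has_integral_cong) (simp only: beta_kernel_of_real)
    finally show ?thesis by (simp add: Beta_complex_of_real integral_unique)
  qed
  have semi: "integral {0<..<1} (beta_kernel p (of_real y)) = Beta p (of_real y)" if "y > 0" "Re p > 0" for p y
    by (rule half_plane_real_continuation[where z = p and f = "\<lambda>p. integral {0<..<1} (beta_kernel p (of_real y))"
          and g = "\<lambda>p. Beta p (of_real y)"])
       (use that in \<open>simp_all add: hol integral_beta_kernel_holomorphic real\<close>)
  \<comment> \<open>Now \<open>p\<close> is a fixed complex number and \<open>q\<close> is
    continued. On the positive axis the identity is \<open>semi\<close> with the two arguments
    exchanged by symmetry.\<close>
  have "integral {0<..<1} (beta_kernel q p) = Beta q p"
  proof (rule half_plane_real_continuation[where z = q])
    show "integral {0<..<1} (beta_kernel (of_real x) p) = Beta (of_real x) p" if "x > 0" for x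
      using semi[OF that assms(1)] integral_beta_kernel_commute[of p "of_real x"] Beta_commute[of p "of_real x"]
      by simp
  qed (use assms in \<open>auto intro!: hol integral_beta_kernel_holomorphic\<close>)
  thus ?thesis
    by (metis integral_beta_kernel_commute Beta_commute)
qed

section \<open>Beta integrals of holomorphic functions on the slit plane\<close>

text \<open>The slit plane is star-shaped about \<open>0\<close>: if the scaled point were on the
  cut, then \<open>z\<close>, no closer to \<open>0\<close> on the same ray, would be on it too.
  Functions on the slit plane can therefore be evaluated along the segment from \<open>0\<close> to
  \<open>z\<close>.\<close>

lemma slit_plane_scale:
  assumes "z \<in> slit_plane" "0 \<le> t" "t \<le> 1"
  shows "of_real t * z \<in> slit_plane"
  unfolding slit_plane_def
proof
  assume "of_real t * z \<in> complex_of_real ` {1..}"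
  then obtain x where x: "x \<ge> 1" "of_real t * z = of_real x" by auto
  with assms have "t > 0" by (cases "t = 0") auto
  hence "z = of_real (x / t)" using x by (simp add: field_simps)
  moreover have "x / t \<ge> 1" using x assms \<open>t > 0\<close> by (simp add: field_simps)
  ultimately show False using assms(1) unfolding slit_plane_def by blast
qed

text \<open>Euler's integral as an operator on functions. On power series it multiplies the
  coefficient of \<open>z ^ n\<close> by \<open>Beta (p + of_nat n) q\<close>. Up to explicit
  factors it serves twice: applied to the binomial quotient it produces the hypergeometric
  remainder, and applied to \<open>1 / (1 - w)\<close> it produces the binomial quotient
  itself.\<close>

definition beta_transform ::
    "complex \<Rightarrow> complex \<Rightarrow> (complex \<Rightarrow> complex) \<Rightarrow> complex \<Rightarrow> complex" where
  "beta_transform p q Q z = integral {0<..<1} (\<lambda>t. beta_kernel p q t * Q (of_real t * z))"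

lemma continuous_on_dilation:
  assumes "Q holomorphic_on slit_plane" "z \<in> slit_plane"
  shows "continuous_on {0..1} (\<lambda>t. Q (of_real t * z))"
  using holomorphic_on_imp_continuous_on[OF assms(1)]
  by (rule continuous_on_compose2) (auto intro!: continuous_intros slit_plane_scale assms)

lemma norm_beta_transform_le:
  assumes "Re p > 0" "Re q > 0" "Q holomorphic_on slit_plane" "z \<in> slit_plane"
    and "\<And>t. t \<in> {0<..<1} \<Longrightarrow> norm (Q (of_real t * z)) \<le> M"
  shows "norm (beta_transform p q Q z) \<le> M * Beta (Re p) (Re q)"
  unfolding beta_transform_def using assms
  by (intro beta_kernel_mult_bound continuous_on_subset[OF continuous_on_dilation]) auto

lemma beta_transform_integrable:
  assumes "Re p > 0" "Re q > 0" "Q holomorphic_on slit_plane" "z \<in> slit_plane"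
  shows "(\<lambda>t. beta_kernel p q t * Q (of_real t * z)) integrable_on {0<..<1}"
proof -
  have cont: "continuous_on {0..1} (\<lambda>t. Q (of_real t * z))"
    by (rule continuous_on_dilation) fact+
  then obtain M where "\<And>t. t \<in> {0..1} \<Longrightarrow> norm (Q (of_real t * z)) \<le> M"
    using compact_continuous_image[OF cont] by (force dest!: compact_imp_bounded simp: bounded_iff)
  thus ?thesis
    by (intro beta_kernel_mult_bound(1)[where M = M] continuous_on_subset[OF cont] assms) auto
qed

lemma beta_transform_holomorphic:
  assumes pq: "Re p > 0" "Re q > 0" and Q: "Q holomorphic_on slit_plane"
  shows "beta_transform p q Q holomorphic_on slit_plane"
  unfolding beta_transform_def
proof (rule holomorphic_on_integral_dominated[OF open_slit_plane])
  show "(\<lambda>t. beta_kernel p q t * Q (of_real t * z)) integrable_on {0<..<1}" if "z \<in> slit_plane" for z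
    by (rule beta_transform_integrable) fact+
  show "(\<lambda>z. beta_kernel p q t * Q (of_real t * z)) holomorphic_on slit_plane"
    if "t \<in> {0<..<1}" for t
    using that
    by (intro holomorphic_intros holomorphic_on_compose_gen[OF _ Q, unfolded o_def])
       (auto intro: slit_plane_scale)
next
  fix z assume "z \<in> slit_plane"
  then obtain e where e: "e > 0" "cball z e \<subseteq> slit_plane"
    using open_slit_plane open_contains_cball by blast
  \<comment> \<open>\<open>K\<close> contains every argument at which \<open>Q\<close> is evaluated
    while \<open>w\<close> varies over the closed disc. It is compact and, by star-shapedness,
    inside the slit plane, so one bound \<open>M\<close> serves all \<open>t\<close> and
    \<open>w\<close>.\<close>
  define K where "K = (\<lambda>(t::real, w). of_real t * w) ` ({0..1} \<times> cball z e)"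
  have "compact K"
    unfolding K_def
    by (intro compact_continuous_image compact_Times) (auto simp: case_prod_unfold intro!: continuous_intros)
  moreover have "K \<subseteq> slit_plane"
    using e by (auto simp: K_def intro!: slit_plane_scale)
  ultimately have "bounded (Q ` K)"
    using Q by (meson compact_continuous_image compact_imp_bounded continuous_on_subset
        holomorphic_on_imp_continuous_on)
  then obtain M where M: "\<And>w. w \<in> K \<Longrightarrow> norm (Q w) \<le> M"
    by (auto simp: bounded_iff)
  show "\<exists>e>0. \<exists>\<psi>. ball z e \<subseteq> slit_plane \<and> \<psi> integrable_on {0<..<1} \<and>
      (\<forall>w\<in>ball z e. \<forall>t\<in>{0<..<1}. norm (beta_kernel p q t * Q (of_real t * w)) \<le> \<psi> t)"
  proof (intro exI conjI ballI)
    show "e > 0" "ball z e \<subseteq> slit_plane" using e by auto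
    show "(\<lambda>t. (t powr (Re p - 1) * (1 - t) powr (Re q - 1)) * M) integrable_on {0<..<1}"
      using has_integral_mult_left[OF has_integral_Beta_Ioo[OF pq]] by blast
    fix w t assume w: "w \<in> ball z e" and t: "t \<in> {0<..<1::real}"
    have "of_real t * w \<in> K"
      using w t by (auto simp: K_def intro!: image_eqI[of _ _ "(t, w)"])
    thus "norm (beta_kernel p q t * Q (of_real t * w)) \<le> (t powr (Re p - 1) * (1 - t) powr (Re q - 1)) * M"
      using M t by (auto simp: norm_mult norm_beta_kernel intro!: mult_left_mono)
  qed
qed

section \<open>Termwise integration and Euler's integral for the hypergeometric remainder\<close>

lemma beta_kernel_mult_power:
  assumes "t \<in> {0<..<1}"
  shows "beta_kernel p q t * of_real t ^ n = beta_kernel (p + of_nat n) q t"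
proof -
  have "of_real t powr (p + of_nat n - 1) = complex_of_real t powr (p - 1) * of_real t ^ n"
    using assms powr_add[of "of_real t" "p - 1" "of_nat n"] by (simp add: powr_nat' algebra_simps)
  thus ?thesis by (simp add: beta_kernel_def)
qed

text \<open>Each factor \<open>t ^ n\<close> shifts \<open>p\<close> to \<open>p + of_nat n\<close>,
  so every term is a complete Beta integral. The modulus of the kernel times the sum of all
  \<open>norm (e n * z ^ n)\<close> dominates the partial sums, which justifies exchanging sum and
  integral.\<close>

lemma beta_transform_sums:
  assumes pq: "Re p > 0" "Re q > 0" 
    and sums: "\<And>w. norm w < 1 \<Longrightarrow> (\<lambda>n. e n * w ^ n) sums Q w" and z: "norm z < 1"
  shows "(\<lambda>n. e n * Beta (p + of_nat n) q * z ^ n) sums beta_transform p q Q z"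
proof -
  \<comment> \<open>Convergence at a point \<open>x\<close> of larger modulus, still in the unit
    disc, yields absolute convergence at \<open>z\<close>.\<close>
  obtain x where x: "norm z < x" "x < 1" using dense[OF z] by blast
  have "summable (\<lambda>n. e n * of_real x ^ n)"
    using sums[of "of_real x"] x norm_ge_zero[of z] by (auto simp: sums_iff)
  hence summ: "summable (\<lambda>n. norm (e n * z ^ n))"
    using x by (intro powser_insidea[of e "of_real x" z]) auto
  define f where "f k t = beta_kernel p q t * (\<Sum>n<k. e n * (of_real t * z) ^ n)" for k t
  have int: "beta_kernel (p + of_nat n) q integrable_on {0<..<1}" for n
    using beta_kernel_mult_bound(1)[of "p + of_nat n" q "\<lambda>_. 1" 1] pq by simp
  have f: "(f k has_integral (\<Sum>n<k. e n * Beta (p + of_nat n) q * z ^ n)) {0<..<1}" for k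
  proof -
    have "((\<lambda>t. \<Sum>n<k. (e n * z ^ n) * beta_kernel (p + of_nat n) q t) has_integral
            (\<Sum>n<k. (e n * z ^ n) * Beta (p + of_nat n) q)) {0<..<1}"
    proof (intro has_integral_sum has_integral_mult_right)
      fix n
      show "(beta_kernel (p + of_nat n) q has_integral Beta (p + of_nat n) q) {0<..<1}"
        using integrable_integral[OF int[of n]] integral_beta_kernel[of "p + of_nat n" q] pq by simp
    qed auto
    also have "(\<Sum>n<k. (e n * z ^ n) * Beta (p + of_nat n) q) = (\<Sum>n<k. e n * Beta (p + of_nat n) q * z ^ n)"
      by (simp add: mult_ac)
    also have "((\<lambda>t. \<Sum>n<k. (e n * z ^ n) * beta_kernel (p + of_nat n) q t) has_integral \<dots>) {0<..<1} \<longleftrightarrow> ?thesis"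
    proof (rule has_integral_cong)
      fix t :: real assume t: "t \<in> {0<..<1}"
      show "(\<Sum>n<k. (e n * z ^ n) * beta_kernel (p + of_nat n) q t) = f k t"
        unfolding f_def sum_distrib_left
        by (simp add: power_mult_distrib mult_ac flip: beta_kernel_mult_power[OF t])
    qed
    finally show ?thesis .
  qed
  have "(\<lambda>k. integral {0<..<1} (f k)) \<longlonglongrightarrow>
          integral {0<..<1} (\<lambda>t. beta_kernel p q t * Q (of_real t * z))"
  proof (rule dominated_convergence)
    show "f k integrable_on {0<..<1}" for k using f by blast
    show "(\<lambda>t. (t powr (Re p - 1) * (1 - t) powr (Re q - 1)) * (\<Sum>n. norm (e n * z ^ n))) integrable_on {0<..<1}"
      using has_integral_mult_left[OF has_integral_Beta_Ioo[OF pq]] by blast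
    fix t :: real assume t: "t \<in> {0<..<1}"
    have tz: "norm (of_real t * z) < 1"
      using t z mult_strict_mono[of t 1 "norm z" 1] by (auto simp: norm_mult mult_le_one)
    show "norm (f k t) \<le> (t powr (Re p - 1) * (1 - t) powr (Re q - 1)) * (\<Sum>n. norm (e n * z ^ n))" for k
    proof -
      have "norm (\<Sum>n<k. e n * (of_real t * z) ^ n) \<le> (\<Sum>n<k. norm (e n * z ^ n))"
      proof (rule sum_norm_le)
        fix n
        have "t ^ n \<le> 1" using t by (intro power_le_one) auto
        hence "(norm (e n) * norm z ^ n) * t ^ n \<le> norm (e n) * norm z ^ n"
          by (intro mult_left_le) auto
        thus "norm (e n * (of_real t * z) ^ n) \<le> norm (e n * z ^ n)"
          using t by (simp add: norm_mult norm_power power_mult_distrib mult_ac)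
      qed
      also have "\<dots> \<le> (\<Sum>n. norm (e n * z ^ n))"
        by (intro sum_le_suminf summ) auto
      finally show ?thesis
        unfolding f_def norm_mult norm_beta_kernel[OF t] by (intro mult_left_mono) auto
    qed
    show "(\<lambda>k. f k t) \<longlonglongrightarrow> beta_kernel p q t * Q (of_real t * z)"
      unfolding f_def using sums[OF tz] by (intro tendsto_intros) (simp add: sums_def)
  qed
  thus ?thesis
    by (simp add: sums_def beta_transform_def integral_unique[OF f])
qed

text \<open>Proved by uniqueness of the continuation: the partial sum plus the integral is
  holomorphic on the slit plane and has the hypergeometric coefficients on the unit disc.
  \<open>Q\<close> enters only through its series and its holomorphy, so any representation of the
  binomial quotient can be inserted.\<close>

lemma hyp2F1_remainder_eq_beta_transform:
  assumes b: "Re b + real N > 0" and cb: "Re c > Re b" and c: "c \<notin> \<int>\<^sub>\<le>\<^sub>0"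
    and Q: "Q holomorphic_on slit_plane"
      "\<And>w. norm w < 1 \<Longrightarrow> (\<lambda>n. pochhammer a (n + N) / fact (n + N) * w ^ n) sums Q w"
    and z: "z \<in> slit_plane"
  shows "hyp2F1_remainder N z a b c =
           Gamma c * rGamma b * rGamma (c - b) * z ^ N * beta_transform (b + of_nat N) (c - b) Q z"
proof -
  let ?B = "beta_transform (b + of_nat N) (c - b) Q"
  let ?C = "Gamma c * rGamma b * rGamma (c - b)"
  have pq: "Re (b + of_nat N) > 0" "Re (c - b) > 0" using b cb by auto
  have nonpole: "w \<notin> \<int>\<^sub>\<le>\<^sub>0" if "Re w > 0" for w :: complex
    using that by (auto elim!: nonpos_Ints_cases)
  \<comment> \<open>Using \<open>rGamma\<close> makes this valid also when \<open>b\<close> is a non-positive integer.\<close>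
  have coeff: "?C * Beta (b + of_nat N + of_nat n) (c - b) = pochhammer b (n + N) / pochhammer c (n + N)" for n
  proof -
    have b': "rGamma b = pochhammer b (n + N) * rGamma (b + of_nat N + of_nat n)"
      using pochhammer_rGamma[of b "n + N"] by (simp add: add_ac)
    have "Re (b + of_nat N + of_nat n) > 0" using b by simp
    hence "rGamma (b + of_nat N + of_nat n) * Gamma (b + of_nat N + of_nat n) = 1"
      using nonpole[of "b + of_nat N + of_nat n"] by (simp add: Gamma_def rGamma_eq_zero_iff del: plus_complex.sel)
    moreover have "rGamma (c - b) * Gamma (c - b) = 1"
      using nonpole[OF pq(2)] by (simp add: Gamma_def rGamma_eq_zero_iff)
    moreover have "Gamma c * rGamma (c + of_nat N + of_nat n) = 1 / pochhammer c (n + N)"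
      using pochhammer_Gamma[OF c, of "n + N"] by (simp add: Gamma_def add_ac field_simps)
    moreover have "?C * Beta (b + of_nat N + of_nat n) (c - b) =
        pochhammer b (n + N) * (rGamma (b + of_nat N + of_nat n) * Gamma (b + of_nat N + of_nat n)) *
        (rGamma (c - b) * Gamma (c - b)) * (Gamma c * rGamma (c + of_nat N + of_nat n))"
      unfolding b' Beta_altdef by (simp add: algebra_simps)
    ultimately show ?thesis by simp
  qed
  have "hyp2F1 a b c z = (\<Sum>n<N. hyp2F1_term a b c z n) + ?C * z ^ N * ?B z"
  proof (rule hyp2F1_eqI[OF _ _ z])
    show "(\<lambda>z. (\<Sum>n<N. hyp2F1_term a b c z n) + ?C * z ^ N * ?B z) holomorphic_on slit_plane"
      unfolding hyp2F1_term_def by (intro holomorphic_intros beta_transform_holomorphic pq Q)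
  next
    fix z :: complex assume z: "norm z < 1"
    have "(\<lambda>n. ?C * z ^ N * (pochhammer a (n + N) / fact (n + N) * Beta (b + of_nat N + of_nat n) (c - b) * z ^ n))
             sums (?C * z ^ N * ?B z)"
      by (intro sums_mult beta_transform_sums pq Q z)
    also have "(\<lambda>n. ?C * z ^ N * (pochhammer a (n + N) / fact (n + N) * Beta (b + of_nat N + of_nat n) (c - b) * z ^ n)) =
               (\<lambda>n. hyp2F1_term a b c z (n + N))"
    proof
      fix n
      have "?C * z ^ N * (pochhammer a (n + N) / fact (n + N) * Beta (b + of_nat N + of_nat n) (c - b) * z ^ n) =
            (?C * Beta (b + of_nat N + of_nat n) (c - b)) * (pochhammer a (n + N) / fact (n + N) * z ^ (n + N))"
        by (simp add: power_add mult_ac)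
      thus "?C * z ^ N * (pochhammer a (n + N) / fact (n + N) * Beta (b + of_nat N + of_nat n) (c - b) * z ^ n) =
            hyp2F1_term a b c z (n + N)"
        unfolding coeff hyp2F1_term_def by simp
    qed
    finally have "hyp2F1_term a b c z sums ((\<Sum>n<N. hyp2F1_term a b c z n) + ?C * z ^ N * ?B z)"
      by (subst (asm) sums_iff_shift) (simp add: add.commute)
    thus "(\<Sum>n<N. hyp2F1_term a b c z n) + ?C * z ^ N * ?B z = (\<Sum>n. hyp2F1_term a b c z n)"
      by (simp add: sums_iff)
  qed
  thus ?thesis by (simp add: hyp2F1_remainder_def)
qed

lemma norm_hyp2F1_remainder_le:
  assumes b: "Re b + real N > 0" and cb: "Re c > Re b" and c: "c \<notin> \<int>\<^sub>\<le>\<^sub>0"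
    and Q: "Q holomorphic_on slit_plane"
      "\<And>w. norm w < 1 \<Longrightarrow> (\<lambda>n. pochhammer a (n + N) / fact (n + N) * w ^ n) sums Q w"
    and z: "z \<in> slit_plane"
    and M: "\<And>t. t \<in> {0<..<1} \<Longrightarrow> norm (Q (of_real t * z)) \<le> M"
  shows "norm (hyp2F1_remainder N z a b c) \<le>
           norm (Gamma c * rGamma b * rGamma (c - b)) * norm z ^ N * M * Beta (Re b + real N) (Re c - Re b)"
proof -
  have "norm (beta_transform (b + of_nat N) (c - b) Q z) \<le> M * Beta (Re (b + of_nat N)) (Re (c - b))"
    using b cb by (intro norm_beta_transform_le Q z M) auto
  note eq = hyp2F1_remainder_eq_beta_transform[OF b cb c Q z]
  from mult_left_mono[OF \<open>norm (beta_transform _ _ _ _) \<le> _\<close>, of "norm (Gamma c * rGamma b * rGamma (c - b)) * norm z ^ N"]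
  show ?thesis
    by (simp add: eq norm_mult norm_power mult_ac)
qed

section \<open>Remainders of the binomial series\<close>

text \<open>The remainder vanishes to order \<open>N\<close> at \<open>0\<close>, so dividing by
  \<open>w ^ N\<close> leaves a removable singularity. On the unit disc the quotient is the shifted
  series, away from \<open>0\<close> it is a quotient of holomorphic functions, and these two open
  sets cover \<open>S\<close>.\<close>

lemma power_series_quotient_exists:
  assumes f: "f holomorphic_on S" and S: "open S" "ball 0 1 \<subseteq> S"
    and sums: "\<And>w. norm w < 1 \<Longrightarrow> (\<lambda>n. e n * w ^ n) sums f w"
  obtains Q where "Q holomorphic_on S"
    and "\<And>w. norm w < 1 \<Longrightarrow> (\<lambda>n. e (n + N) * w ^ n) sums Q w"
    and "\<And>w. w \<in> S \<Longrightarrow> w ^ N * Q w = f w - (\<Sum>n<N. e n * w ^ n)"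
proof -
  let ?r = "\<lambda>w. f w - (\<Sum>n<N. e n * w ^ n)"
  define s where "s w = (if w = 0 then e N else ?r w / w ^ N)" for w
  have s_sums: "(\<lambda>n. e (n + N) * w ^ n) sums s w" if w: "norm w < 1" for w
  proof (cases "w = 0")
    case True
    thus ?thesis using powser_sums_zero[of "\<lambda>n. e (n + N)"] by (simp add: s_def)
  next
    case False
    have "(\<lambda>n. e (n + N) * w ^ (n + N) / w ^ N) sums (?r w / w ^ N)"
      by (intro sums_divide sums_split_initial_segment sums w)
    thus ?thesis using False by (simp add: s_def power_add)
  qed
  have "s holomorphic_on ball 0 1"
    by (rule power_series_holomorphic[where a = "\<lambda>n. e (n + N)"]) (use s_sums in auto)
  moreover have "s holomorphic_on (S - {0})"
  proof (rule holomorphic_transform)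
    show "(\<lambda>w. ?r w / w ^ N) holomorphic_on (S - {0})"
      by (intro holomorphic_intros holomorphic_on_subset[OF f]) auto
  qed (auto simp: s_def)
  ultimately have "s holomorphic_on (ball 0 1 \<union> (S - {0}))"
    using S by (intro holomorphic_on_Un) auto
  moreover have "ball 0 1 \<union> (S - {0}) = S" using S(2) by force
  moreover have "w ^ N * s w = ?r w" if "w \<in> S" for w
  proof (cases "w = 0")
    case True
    have "f 0 = e 0"
      using sums_unique2[OF sums[of 0] powser_sums_zero[of e]] by simp
    \<comment> \<open>Here \<open>0 ^ 0 = 1\<close> matters: for \<open>N > 0\<close> both sides of
      the claim vanish at \<open>0\<close>, whereas for \<open>N = 0\<close> the sum is empty and
      both sides are \<open>e 0\<close>.\<close>
    moreover have "(\<Sum>n<N. e n * 0 ^ n) = (if N = 0 then 0 else e 0)"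
      by (cases N) (auto simp: sum.lessThan_Suc_shift)
    ultimately show ?thesis using True by (auto simp: s_def)
  qed (simp add: s_def)
  ultimately show thesis using that[of s] s_sums by simp
qed

text \<open>The removed ray is where \<open>1 - z\<close> meets the branch cut of the principal
  power, so the binomial function is holomorphic off it.\<close>

lemma one_minus_not_nonpos_Reals: "z \<in> slit_plane \<Longrightarrow> 1 - z \<notin> \<real>\<^sub>\<le>\<^sub>0"
  by (auto simp: slit_plane_def complex_nonpos_Reals_iff image_iff complex_eq_iff)

lemma binomial_series_pochhammer:
  fixes a w :: complex
  assumes "norm w < 1"
  shows "(\<lambda>n. pochhammer a n / fact n * w ^ n) sums ((1 - w) powr (- a))"
proof -
  have "(\<lambda>n. ((- a) gchoose n) * (- w) ^ n) sums ((1 + (- w)) powr (- a))"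
    by (rule gen_binomial_complex) (use assms in simp)
  moreover have "((- a) gchoose n) * (- w) ^ n = pochhammer a n / fact n * w ^ n" for n
  proof -
    have "(- 1) ^ n * (- 1) ^ n = (1 :: complex)"
      by (simp flip: power_mult_distrib)
    thus ?thesis
      by (simp add: gbinomial_pochhammer power_minus[of w n])
  qed
  ultimately show ?thesis by (simp only: diff_conv_add_uminus)
qed

lemma binomial_quotient_exists:
  fixes a :: complex
  obtains Q where "Q holomorphic_on slit_plane"
    and "\<And>w. norm w < 1 \<Longrightarrow> (\<lambda>n. pochhammer a (n + N) / fact (n + N) * w ^ n) sums Q w"
    and "\<And>w. w \<in> slit_plane \<Longrightarrow>
           w ^ N * Q w = (1 - w) powr (- a) - (\<Sum>n<N. pochhammer a n / fact n * w ^ n)"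
proof (rule power_series_quotient_exists[where f = "\<lambda>w. (1 - w) powr (- a)" and S = slit_plane and N = N
      and e = "\<lambda>n. pochhammer a n / fact n"])
  show "(\<lambda>w. (1 - w) powr - a) holomorphic_on slit_plane"
    by (intro holomorphic_intros) (use one_minus_not_nonpos_Reals in auto)
qed (use that open_slit_plane unit_ball_subset_slit_plane binomial_series_pochhammer in auto)

section \<open>Arguments in a half plane, and size and sign of the binomial remainder\<close>

lemma Arg_one_plus_le:
  assumes "Re x \<ge> 0" "Im x \<ge> 0"
  shows "Arg (1 + x) \<le> Arg x"
proof (cases "x = 0")
  case False
  define u v where "u = Re x" and "v = Im x"
  have uv: "u \<ge> 0" "v \<ge> 0" using assms by (auto simp: u_def v_def)
  have cos_Arg': "cos (Arg y) = Re y / norm y" if "y \<noteq> 0" for y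
    using arg_cong[OF rcis_cmod_Arg[of y], of Re] that by (simp add: rcis_def field_simps)
  have "1 + x \<noteq> 0" using assms by (auto simp: complex_eq_iff)
  \<comment> \<open>Cosine decreases on the range of both angles, so they are compared through
    \<open>Re y / norm y\<close>. After squaring, the common term
    \<open>u\<^sup>2 * (1 + u)\<^sup>2\<close> cancels and
    \<open>u\<^sup>2 * v\<^sup>2 \<le> (1 + u)\<^sup>2 * v\<^sup>2\<close> remains.\<close>
  have "(u * norm (1 + x))\<^sup>2 \<le> ((1 + u) * norm x)\<^sup>2"
  proof -
    have "u\<^sup>2 * v\<^sup>2 \<le> (1 + u)\<^sup>2 * v\<^sup>2"
      using uv by (intro mult_right_mono power_mono) auto
    thus ?thesis
      unfolding power_mult_distrib cmod_power2 by (simp add: u_def v_def algebra_simps)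
  qed
  hence "u * norm (1 + x) \<le> (1 + u) * norm x"
    by (rule power2_le_imp_le) (use uv in auto)
  hence "Re x / norm x \<le> Re (1 + x) / norm (1 + x)"
    using False \<open>1 + x \<noteq> 0\<close> by (simp add: field_simps u_def)
  hence "cos (Arg x) \<le> cos (Arg (1 + x))"
    using False \<open>1 + x \<noteq> 0\<close> by (simp add: cos_Arg')
  thus ?thesis
    using assms Arg_le_pi Arg_less_0[of x] Arg_less_0[of "1 + x"]
    by (subst (asm) cos_mono_le_eq) auto
qed (simp add: Arg_zero)

text \<open>\<open>Arg (1 + x)\<close> lies between \<open>0\<close> and \<open>Arg x\<close>, in
  the lower half plane by conjugation. Its product with \<open>y\<close> thus lies between
  \<open>0\<close> and \<open>y * Arg x\<close>, whatever the sign of \<open>y\<close>; the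
  exponential of this is the source of the maximum in the final bound.\<close>

lemma times_Arg_one_plus_le:
  assumes "Re x \<ge> 0"
  shows "y * Arg (1 + x) \<le> max 0 (y * Arg x)"
proof -
  have key: "0 \<le> Arg (1 + x) \<and> Arg (1 + x) \<le> Arg x" if "Re x \<ge> 0" "Im x \<ge> 0" for x
    using Arg_one_plus_le[OF that] Arg_less_0[of "1 + x"] that by simp
  have *: "y * A \<le> max 0 (y * B)" if "0 \<le> A \<and> A \<le> B" for A B :: real and y
    using that by (cases "y \<ge> 0") (auto simp: mult_left_mono max_def mult_nonpos_nonneg order_trans[of _ 0])
  show ?thesis
  proof (cases "Im x \<ge> 0")
    case True
    thus ?thesis using * key[OF assms] by blast
  next
    case False
    hence "x \<notin> \<real>" "1 + x \<notin> \<real>" by (auto simp: complex_is_Real_iff)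
    hence "Arg (cnj x) = - Arg x" "Arg (1 + cnj x) = - Arg (1 + x)"
      using Arg_cnj[of x] Arg_cnj[of "1 + x"] by auto
    thus ?thesis
      using *[of "Arg (1 + cnj x)" "Arg (cnj x)" "-y"] key[of "cnj x"] assms False by simp
  qed
qed

text \<open>Induction on \<open>N\<close>: the derivative of the \<open>(N+1)\<close>-st remainder for \<open>a\<close> is \<open>a\<close> times the
  \<open>N\<close>-th remainder for \<open>a + 1\<close>, and \<open>Arg (- w)\<close> is constant along the ray through \<open>w\<close>.\<close>

lemma norm_binomial_remainder_le:
  fixes a w :: complex
  assumes "Re a + real N \<ge> 0" "Re w \<le> 0"
  shows "norm ((1 - w) powr (- a) - (\<Sum>n<N. pochhammer a n / fact n * w ^ n)) \<le>
           norm (pochhammer a N) / fact N * norm w ^ N * max 1 (exp (Im a * Arg (- w)))"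
  using assms
proof (induction N arbitrary: a w)
  case 0
  \<comment> \<open>For \<open>N = 0\<close> the hypothesis reads \<open>Re a \<ge> 0\<close>. With
    \<open>norm (1 - w) \<ge> 1\<close> the modulus part of the power is at most \<open>1\<close>,
    and only the exponential of \<open>Im a * Arg (1 - w)\<close> is left.\<close>
  have "norm (1 - w) \<ge> 1"
    using complex_Re_le_cmod[of "1 - w"] 0 by simp
  moreover have "norm (1 - w) powr (- Re a) \<le> norm (1 - w) powr 0"
    using 0 calculation by (intro powr_mono) auto
  ultimately have "norm ((1 - w) powr (- a)) \<le> exp (Im a * Arg (1 - w))"
    by (auto simp: norm_powr_complex split: if_splits intro!: mult_left_le_one_le)
  also have "\<dots> \<le> exp (max 0 (Im a * Arg (- w)))"
    using times_Arg_one_plus_le[of "- w" "Im a"] 0 by simp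
  also have "\<dots> = max 1 (exp (Im a * Arg (- w)))"
    by (simp add: max_def)
  finally show ?case by simp
next
  case (Suc N)
  define M where "M = max 1 (exp (Im a * Arg (- w)))"
  define r where "r N a w = (1 - w) powr (- a) - (\<Sum>n<N. pochhammer a n / fact n * w ^ n)"
    for N and a w :: complex
  define K where "K = norm a * norm (pochhammer (a + 1) N) / fact N * norm w ^ Suc N * M"
  have deriv: "(r (Suc N) a has_field_derivative a * r N (a + 1) x) (at x)" if "Re x \<le> 0" for x
  proof -
    have nz: "1 - x \<notin> \<real>\<^sub>\<le>\<^sub>0" using that by (auto simp: complex_nonpos_Reals_iff)
    have "((\<lambda>w. (1 - w) powr (- a)) has_field_derivative a * (1 - x) powr (- a - 1)) (at x)"
      using nz by (auto intro!: derivative_eq_intros)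
    moreover have "- a - 1 = - (a + 1)" by simp
    ultimately have "((\<lambda>w. (1 - w) powr (- a)) has_field_derivative a * (1 - x) powr (- (a + 1))) (at x)"
      by (simp only:)
    moreover have "((\<lambda>w. \<Sum>n<Suc N. pochhammer a n / fact n * w ^ n) has_field_derivative
        a * (\<Sum>n<N. pochhammer (a + 1) n / fact n * x ^ n)) (at x)"
    proof -
      have "((\<lambda>w. \<Sum>n<Suc N. pochhammer a n / fact n * w ^ n) has_field_derivative
          (\<Sum>n<Suc N. pochhammer a n / fact n * (of_nat n * x ^ (n - 1)))) (at x)"
        by (rule derivative_eq_intros | simp add: mult_ac)+
      also have "(\<Sum>n<Suc N. pochhammer a n / fact n * (of_nat n * x ^ (n - 1))) =
                 (\<Sum>n<N. pochhammer a (Suc n) / fact (Suc n) * (of_nat (Suc n) * x ^ n))"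
        by (subst sum.lessThan_Suc_shift) simp
      also have "\<dots> = a * (\<Sum>n<N. pochhammer (a + 1) n / fact n * x ^ n)"
        unfolding sum_distrib_left
        by (intro sum.cong refl) (simp add: pochhammer_rec fact_Suc field_simps del: of_nat_Suc)
      finally show ?thesis .
    qed
    ultimately show ?thesis
      unfolding r_def right_diff_distrib by (rule DERIV_diff)
  qed
  \<comment> \<open>Along the ray the derivative is at most \<open>K * s ^ N\<close>, whose
    primitive is the comparison function. Its value at \<open>1\<close> supplies the factor
    \<open>1 / real (Suc N)\<close> that completes the factorial.\<close>
  have "norm (r (Suc N) a (of_real 1 * w) - r (Suc N) a (of_real 0 * w)) \<le>
          K * 1 ^ Suc N / real (Suc N) - K * 0 ^ Suc N / real (Suc N)"
  proof (rule differentiable_bound_general[where f = "\<lambda>s. r (Suc N) a (of_real s * w)"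
        and \<phi> = "\<lambda>s. K * s ^ Suc N / real (Suc N)" and \<phi>' = "\<lambda>s. K * s ^ N"
        and f' = "\<lambda>s. w * (a * r N (a + 1) (of_real s * w))"])
    have vd: "((\<lambda>s. r (Suc N) a (of_real s * w)) has_vector_derivative w * (a * r N (a + 1) (of_real s * w))) (at s)"
      if "0 \<le> s" for s :: real
    proof -
      have "((\<lambda>s. of_real s * w) has_vector_derivative w) (at s)"
        by (auto intro!: derivative_eq_intros)
      moreover have "Re (of_real s * w) \<le> 0"
        using that Suc.prems by (simp add: mult_nonneg_nonpos)
      ultimately show ?thesis
        by (rule field_vector_diff_chain_at[OF _ deriv, unfolded o_def])
    qed
    show "continuous_on {0..1} (\<lambda>s. r (Suc N) a (of_real s * w))"
      by (intro continuous_at_imp_continuous_on ballI) (auto intro: vd has_vector_derivative_continuous)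
    fix s :: real assume s: "0 < s" "s < 1"
    show "((\<lambda>s. r (Suc N) a (of_real s * w)) has_vector_derivative w * (a * r N (a + 1) (of_real s * w))) (at s)"
      by (rule vd) (use s in simp)
    show "((\<lambda>s. K * s ^ Suc N / real (Suc N)) has_vector_derivative K * s ^ N) (at s)"
      unfolding has_real_derivative_iff_has_vector_derivative[symmetric]
      using DERIV_cdivide[OF DERIV_cmult[OF DERIV_pow[of "Suc N" s]], of K "real (Suc N)"]
      by (simp del: of_nat_Suc power_Suc)
    have Arg: "Arg (- (of_real s * w)) = Arg (- w)"
      using Arg_times_of_real[of s "- w"] s by simp
    \<comment> \<open>Passing from \<open>a\<close> and \<open>Suc N\<close> to \<open>a + 1\<close>
      and \<open>N\<close> preserves both the sum in the hypothesis and \<open>Im a\<close>, so the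
      same factor \<open>M\<close> appears.\<close>
    have "norm (r N (a + 1) (of_real s * w)) \<le>
            norm (pochhammer (a + 1) N) / fact N * norm (of_real s * w) ^ N *
            max 1 (exp (Im (a + 1) * Arg (- (of_real s * w))))"
      unfolding r_def using Suc.prems s by (intro Suc.IH) (auto simp: mult_nonneg_nonpos)
    also have "\<dots> = norm (pochhammer (a + 1) N) / fact N * (s * norm w) ^ N * M"
      unfolding Arg using s by (simp add: M_def norm_mult)
    finally have "norm (w * a) * norm (r N (a + 1) (of_real s * w)) \<le>
        norm (w * a) * (norm (pochhammer (a + 1) N) / fact N * (s * norm w) ^ N * M)"
      by (intro mult_left_mono) auto
    thus "norm (w * (a * r N (a + 1) (of_real s * w))) \<le> K * s ^ N"
      by (simp add: K_def norm_mult power_mult_distrib mult_ac)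
  qed (auto intro!: continuous_intros)
  moreover have "r (Suc N) a 0 = 0"
    unfolding r_def sum.lessThan_Suc_shift by simp
  moreover have "K * 1 ^ Suc N / real (Suc N) - K * 0 ^ Suc N / real (Suc N) =
      norm (pochhammer a (Suc N)) / fact (Suc N) * norm w ^ Suc N * M"
    by (simp add: K_def pochhammer_rec norm_mult del: of_nat_Suc)
  ultimately show ?case
    by (simp add: r_def M_def del: sum.lessThan_Suc of_nat_Suc)
qed

text \<open>Lagrange's form of the remainder: \<open>\<theta>\<close> is the positive power
  \<open>(1 - t) powr (- \<alpha> - real N)\<close> at an intermediate point \<open>t\<close>
  between \<open>x\<close> and \<open>0\<close>.\<close>

lemma binomial_remainder_sign:
  fixes \<alpha> x :: real
  assumes "x < 0"
  shows "\<exists>\<theta>>0. (1 - x) powr (- \<alpha>) - (\<Sum>n<N. pochhammer \<alpha> n / fact n * x ^ n) =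
            pochhammer \<alpha> N / fact N * x ^ N * \<theta>"
proof (cases "N = 0")
  \<comment> \<open>Taylor's theorem is applied for positive \<open>N\<close>; here the sum is empty
    and the function value itself is \<open>\<theta>\<close>.\<close>
  case True
  thus ?thesis using assms by (intro exI[of _ "(1 - x) powr (- \<alpha>)"]) auto
next
  case False
  have "\<exists>t>x. t < 0 \<and> (1 - x) powr (- \<alpha>) =
      (\<Sum>m<N. (pochhammer \<alpha> m * (1 - 0) powr (- \<alpha> - real m)) / fact m * x ^ m) +
      (pochhammer \<alpha> N * (1 - t) powr (- \<alpha> - real N)) / fact N * x ^ N"
  proof (rule Maclaurin_minus)
    show "\<forall>m t. m < N \<and> x \<le> t \<and> t \<le> 0 \<longrightarrow>
        DERIV (\<lambda>t. pochhammer \<alpha> m * (1 - t) powr (- \<alpha> - real m)) t :>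
          pochhammer \<alpha> (Suc m) * (1 - t) powr (- \<alpha> - real (Suc m))"
      by (auto intro!: derivative_eq_intros simp: pochhammer_Suc algebra_simps)
  qed (use assms False in auto)
  then obtain t where t: "t < 0" and eq: "(1 - x) powr (- \<alpha>) =
      (\<Sum>m<N. pochhammer \<alpha> m / fact m * x ^ m) +
      (pochhammer \<alpha> N * (1 - t) powr (- \<alpha> - real N)) / fact N * x ^ N"
    by auto
  show ?thesis
    by (intro exI[of _ "(1 - t) powr (- \<alpha> - real N)"]) (use t eq in auto)
qed

section \<open>Bounds for the hypergeometric remainder\<close>

lemma of_real_pochhammer:
  "pochhammer (of_real x :: 'a::real_normed_field) n = of_real (pochhammer x n)"
  by (induction n) (simp_all add: pochhammer_Suc)

text \<open>Off the integers this is the reflection formula. The Gamma expression is continuous on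
  the whole interval from \<open>- real N\<close> to \<open>1\<close>, so at an integer there it is
  the limit.\<close>

lemma pochhammer_over_sin_eq:
  assumes "- real N < x" "x < 1"
  shows "pochhammer_over_sin x N = Gamma (x + real N) * Gamma (1 - x) / pi"
proof -
  have eq: "pochhammer t N / sin (pi * t) = Gamma (t + real N) * Gamma (1 - t) / pi" if "t \<notin> \<int>" for t :: real
  proof -
    have t: "t \<notin> \<int>\<^sub>\<le>\<^sub>0" using that by (meson nonpos_Ints_Int)
    have "Gamma t * Gamma (1 - t) = pi / sin (pi * t)"
    proof -
      have "complex_of_real (Gamma t * Gamma (1 - t)) = of_real (pi / sin (pi * t))"
        using Gamma_reflection_complex[of "of_real t"] Gamma_complex_of_real[of t]
          Gamma_complex_of_real[of "1 - t"] sin_of_real[of "pi * t", where ?'a = complex] by simp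
      thus ?thesis by (simp only: of_real_eq_iff)
    qed
    hence "1 / sin (pi * t) = Gamma t * Gamma (1 - t) / pi"
      by (simp add: field_simps)
    moreover have "Gamma t \<noteq> 0" using t by (simp add: Gamma_eq_zero_iff)
    ultimately show ?thesis
      using pochhammer_Gamma[OF t, of N] by (simp add: divide_inverse mult_ac)
  qed
  show ?thesis
  proof (cases "x \<in> \<int>")
    case False
    thus ?thesis by (simp add: pochhammer_over_sin_def eq)
  next
    case True
    have nonpole: "y \<notin> \<int>\<^sub>\<le>\<^sub>0" if "y > 0" for y :: real
      using that by (auto elim!: nonpos_Ints_cases)
    have "((\<lambda>t. Gamma (t + real N) * Gamma (1 - t) / pi) \<longlongrightarrow> Gamma (x + real N) * Gamma (1 - x) / pi) (at x)"
      by (intro tendsto_intros nonpole) (use assms in auto)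
    moreover have "\<forall>\<^sub>F t in at x. Gamma (t + real N) * Gamma (1 - t) / pi = pochhammer t N / sin (pi * t)"
      unfolding eventually_at
    proof (intro exI[of _ 1] conjI ballI impI)
      \<comment> \<open>Distinct integers are at least \<open>1\<close> apart, so the punctured
        neighbourhood of radius \<open>1\<close> about the integer \<open>x\<close> contains
        none.\<close>
      fix t assume t: "t \<noteq> x \<and> dist t x < 1"
      have "t \<notin> \<int>"
      proof
        assume "t \<in> \<int>"
        then obtain m n where "t = of_int m" "x = of_int n" using True by (auto elim!: Ints_cases)
        thus False using t by (auto simp: dist_real_def simp flip: of_int_diff)
      qed
      thus "Gamma (t + real N) * Gamma (1 - t) / pi = pochhammer t N / sin (pi * t)"
        using eq by simp
    qed simp
    ultimately have "((\<lambda>t. pochhammer t N / sin (pi * t)) \<longlongrightarrow> Gamma (x + real N) * Gamma (1 - x) / pi) (at x)"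
      by (rule Lim_transform_eventually)
    thus ?thesis
      using True by (simp add: pochhammer_over_sin_def tendsto_Lim)
  qed
qed

lemma Gamma_pochhammer_eq: "Gamma_pochhammer x N = Gamma (x + real N)"
proof (cases "x \<in> \<int>\<^sub>\<le>\<^sub>0")
  case False
  hence "Gamma x \<noteq> 0" by (simp add: Gamma_eq_zero_iff)
  thus ?thesis
    using False pochhammer_Gamma[of x N] by (simp add: Gamma_pochhammer_def)
qed (simp add: Gamma_pochhammer_def)

text \<open>The bound is the reciprocal distance from \<open>1\<close> to the segment from
  \<open>0\<close> to \<open>z\<close>. The foot of the perpendicular has parameter
  \<open>Re z / (norm z)\<^sup>2\<close>. If this is at most \<open>0\<close>, the nearest point is
  \<open>0\<close>; if it lies in the segment, the distance is
  \<open>\<bar>Im z\<bar> / norm z\<close>; if it exceeds \<open>1\<close>, the nearest point is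
  \<open>z\<close>.\<close>

lemma norm_inverse_one_minus_scaled_le:
  assumes z: "z \<in> slit_plane" and s: "0 \<le> s" "s \<le> 1"
  shows "norm (1 / (1 - of_real s * z)) \<le>
           (if Re z \<le> 0 then 1
            else if Re z \<le> (norm z)\<^sup>2 then norm (z / complex_of_real (Im z))
            else 1 / norm (1 - z))"
proof -
  have nz: "1 - of_real s * z \<noteq> 0"
    using slit_plane_scale[OF z s] by (force simp: slit_plane_def)
  consider "Re z \<le> 0" | "Re z > 0" "Re z \<le> (norm z)\<^sup>2" | "Re z > 0" "Re z > (norm z)\<^sup>2"
    by linarith
  thus ?thesis
  proof cases
    case 1
    have "s * Re z \<le> 0" using 1 s by (simp add: mult_nonneg_nonpos)
    hence "1 \<le> norm (1 - of_real s * z)"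
      using complex_Re_le_cmod[of "1 - of_real s * z"] by simp
    thus ?thesis using 1 by (simp add: norm_divide divide_le_eq)
  next
    case 2
    have "Im z \<noteq> 0"
    proof
      assume "Im z = 0"
      hence "z = of_real (Re z)" by (simp add: complex_eq_iff)
      moreover have "Re z \<ge> 1"
        using 2 \<open>Im z = 0\<close> unfolding cmod_power2 by (simp add: power2_eq_square)
      ultimately show False using z unfolding slit_plane_def by (metis ComplD atLeast_iff image_eqI)
    qed
    \<comment> \<open>Multiplication by \<open>cnj z\<close> makes the term
      \<open>of_real s * z\<close> real, so the imaginary part is independent of
      \<open>s\<close>.\<close>
    have "\<bar>Im z\<bar> = \<bar>Im ((1 - of_real s * z) * cnj z)\<bar>"
      by (simp add: algebra_simps)
    also have "\<dots> \<le> norm ((1 - of_real s * z) * cnj z)"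
      by (rule abs_Im_le_cmod)
    finally have "\<bar>Im z\<bar> \<le> norm (1 - of_real s * z) * norm z"
      by (simp add: norm_mult)
    thus ?thesis using 2 \<open>Im z \<noteq> 0\<close> nz by (simp add: norm_divide field_simps)
  next
    case 3
    have "(norm z)\<^sup>2 * (1 + s) \<le> (norm z)\<^sup>2 * 2"
      using s by (intro mult_left_mono) auto
    \<comment> \<open>The right-hand side equals
      \<open>(norm (1 - of_real s * z))\<^sup>2 - (norm (1 - z))\<^sup>2\<close>.\<close>
    hence "0 \<le> (1 - s) * (2 * Re z - (norm z)\<^sup>2 * (1 + s))"
      using s 3 by (intro mult_nonneg_nonneg) auto
    hence "(norm (1 - z))\<^sup>2 \<le> (norm (1 - of_real s * z))\<^sup>2"
      unfolding cmod_power2 by (simp add: power2_eq_square algebra_simps)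
    hence "norm (1 - z) \<le> norm (1 - of_real s * z)"
      by (rule power2_le_imp_le) simp
    moreover have "1 - z \<noteq> 0" using z by (force simp: slit_plane_def)
    ultimately show ?thesis using 3 by (simp add: norm_divide frac_le)
  qed
qed

section \<open>The bounds for complex parameters: left half plane, then slit plane\<close>

lemma hyp2F1_remainder_bound_left_half_plane:
  fixes N :: nat and a b c :: complex
  assumes a: "Re a + real N > 0" and b: "Re b + real N > 0" and cb: "Re c > Re b" and c: "c \<notin> \<int>\<^sub>\<le>\<^sub>0"
    and z: "Re z \<le> 0"
  shows "norm (hyp2F1_remainder N z a b c) \<le>
          norm (complex_of_real (Gamma (Re b + real N)) * Gamma (c + of_nat N)
                  * complex_of_real (Gamma (Re c - Re b))
                / (Gamma (b + of_nat N) * complex_of_real (Gamma (Re c + real N))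
                  * Gamma (c - b)))
          * norm (hyp2F1_term a b c z N)
          * max 1 (exp (Im a * Arg (- z)))"
proof -
  obtain Q where Q: "Q holomorphic_on slit_plane"
    "\<And>w. norm w < 1 \<Longrightarrow> (\<lambda>n. pochhammer a (n + N) / fact (n + N) * w ^ n) sums Q w"
    "\<And>w. w \<in> slit_plane \<Longrightarrow>
       w ^ N * Q w = (1 - w) powr (- a) - (\<Sum>n<N. pochhammer a n / fact n * w ^ n)"
    using binomial_quotient_exists by blast
  have slit: "z \<in> slit_plane" using z by (auto simp: slit_plane_def)
  define m where "m = max 1 (exp (Im a * Arg (- z)))"
  have M: "norm (Q (of_real t * z)) \<le> norm (pochhammer a N) / fact N * m" if t: "t \<in> {0<..<1}" for t
  proof (cases "z = 0")
    \<comment> \<open>The estimate of \<open>w ^ N * Q w\<close> cannot in general be divided by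
      \<open>w ^ N\<close> at \<open>w = 0\<close>; the value of \<open>Q\<close> is read off as the
      constant term of its series.\<close>
    case True
    have "Q 0 = pochhammer a N / fact N"
      using sums_unique2[OF Q(2)[of 0] powser_sums_zero] by simp
    moreover have "norm (pochhammer a N) / fact N * 1 \<le> norm (pochhammer a N) / fact N * m"
      unfolding m_def by (intro mult_left_mono) auto
    ultimately show ?thesis using True by (simp add: norm_divide)
  next
    case False
    let ?w = "of_real t * z"
    have nz: "norm ?w ^ N > 0" using False t by simp
    have Arg: "Arg (- ?w) = Arg (- z)" using Arg_times_of_real[of t "- z"] t by simp
    have w: "?w \<in> slit_plane" using t by (intro slit_plane_scale slit) auto
    have "norm (?w ^ N * Q ?w) \<le>
        norm (pochhammer a N) / fact N * norm ?w ^ N * max 1 (exp (Im a * Arg (- ?w)))"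
      unfolding Q(3)[OF w] using a z t by (intro norm_binomial_remainder_le) (auto simp: mult_nonneg_nonpos)
    hence "norm ?w ^ N * norm (Q ?w) \<le> norm ?w ^ N * (norm (pochhammer a N) / fact N * m)"
      unfolding Arg m_def by (simp only: norm_mult norm_power mult_ac)
    thus ?thesis using nz by (simp only: mult_le_cancel_left_pos)
  qed
  have "c - b \<notin> \<int>\<^sub>\<le>\<^sub>0" "b + of_nat N \<notin> \<int>\<^sub>\<le>\<^sub>0" using cb b by (auto elim!: nonpos_Ints_cases simp: complex_eq_iff)
  hence nz: "Gamma (c - b) \<noteq> 0" "Gamma (b + of_nat N) \<noteq> 0" "Gamma c \<noteq> 0"
    using c by (auto simp: Gamma_eq_zero_iff)
  have c': "pochhammer c N \<noteq> 0"
    using c pochhammer_eq_0_imp_nonpos_Int by blast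
  have Gc: "Gamma (c + of_nat N) = Gamma c * pochhammer c N"
    using pochhammer_Gamma[OF c, of N] nz by simp
  \<comment> \<open>Since \<open>Re b + real N > 0\<close>, the denominator is a nonzero Gamma value
    even when \<open>b\<close> is a non-positive integer; then \<open>rGamma b\<close> and
    \<open>pochhammer b N\<close> both vanish.\<close>
  have Gb: "rGamma b = pochhammer b N / Gamma (b + of_nat N)"
    using pochhammer_rGamma[of b N] by (simp add: rGamma_inverse_Gamma divide_inverse)
  have pos: "Gamma (Re b + real N) > 0" "Gamma (Re c + real N) > 0" "Gamma (Re c - Re b) > 0"
    using b cb by auto
  have Beta: "Beta (Re b + real N) (Re c - Re b) =
      Gamma (Re b + real N) * Gamma (Re c - Re b) / Gamma (Re c + real N)"
    by (simp add: Beta_def add_ac)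
  have "norm (hyp2F1_remainder N z a b c) \<le> norm (Gamma c * rGamma b * rGamma (c - b)) * norm z ^ N *
      (norm (pochhammer a N) / fact N * m) * Beta (Re b + real N) (Re c - Re b)"
    by (rule norm_hyp2F1_remainder_le[OF b cb c Q(1,2) slit M])
  also have "\<dots> = norm (complex_of_real (Gamma (Re b + real N)) * Gamma (c + of_nat N)
                  * complex_of_real (Gamma (Re c - Re b))
                / (Gamma (b + of_nat N) * complex_of_real (Gamma (Re c + real N))
                  * Gamma (c - b)))
          * norm (hyp2F1_term a b c z N) * m"
    unfolding Gc Gb Beta hyp2F1_term_def rGamma_inverse_Gamma[of "c - b"] norm_mult norm_divide norm_inverse norm_power
    using c' nz pos by (simp add: field_simps)
  finally show ?thesis unfolding m_def .
qed

text \<open>All Taylor coefficients of \<open>1 / (1 - w)\<close> are \<open>1\<close>, so its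
  transform with parameters \<open>a + of_nat N\<close> and \<open>1 - a\<close> has coefficients
  \<open>Beta (a + of_nat N + of_nat n) (1 - a)\<close>. Multiplied by
  \<open>rGamma a * rGamma (1 - a)\<close>, which is \<open>sin (pi * a) / pi\<close>, they are
  those of the binomial quotient. The conditions on \<open>Re a\<close> are those for convergence of
  this integral.\<close>

lemma hyp2F1_remainder_bound_slit_plane:
  fixes N :: nat and a b c :: complex
  assumes a: "Re a + real N > 0" "Re a < 1" and b: "Re b + real N > 0" and cb: "Re c > Re b"
    and c: "c \<notin> \<int>\<^sub>\<le>\<^sub>0" and z: "z \<in> slit_plane"
  shows "norm (hyp2F1_remainder N z a b c) \<le>
          norm (sin (complex_of_real pi * a) * complex_of_real (pochhammer_over_sin (Re a) N))
          * norm (complex_of_real (Gamma_pochhammer (Re b) N) * Gamma c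
                    * complex_of_real (Gamma (Re c - Re b))
                  / (Gamma b * complex_of_real (Gamma_pochhammer (Re c) N) * Gamma (c - b)))
          * norm (z ^ N / fact N)
          * (if Re z \<le> 0 then 1
             else if Re z \<le> (norm z)\<^sup>2 then norm (z / complex_of_real (Im z))
             else 1 / norm (1 - z))"
proof -
  let ?B = "beta_transform (a + of_nat N) (1 - a) (\<lambda>w. 1 / (1 - w))"
  define D where "D = (if Re z \<le> 0 then 1
             else if Re z \<le> (norm z)\<^sup>2 then norm (z / complex_of_real (Im z))
             else 1 / norm (1 - z))"
  define Q where "Q w = rGamma a * rGamma (1 - a) * ?B w" for w
  have pq: "Re (a + of_nat N) > 0" "Re (1 - a) > 0" using a by auto
  have nonpole: "w \<notin> \<int>\<^sub>\<le>\<^sub>0" if "Re w > 0" for w :: complex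
    using that by (auto elim!: nonpos_Ints_cases)
  have hol: "(\<lambda>w. 1 / (1 - w)) holomorphic_on slit_plane"
    by (intro holomorphic_intros) (force simp: slit_plane_def)
  have Q_hol: "Q holomorphic_on slit_plane"
    unfolding Q_def by (intro holomorphic_intros beta_transform_holomorphic hol pq)
  have Q_sums: "(\<lambda>n. pochhammer a (n + N) / fact (n + N) * w ^ n) sums Q w" if w: "norm w < 1" for w
  proof -
    have "(\<lambda>n. 1 * Beta (a + of_nat N + of_nat n) (1 - a) * w ^ n) sums ?B w"
      by (rule beta_transform_sums) (use pq w geometric_sums in auto)
    hence "(\<lambda>n. rGamma a * rGamma (1 - a) * (1 * Beta (a + of_nat N + of_nat n) (1 - a) * w ^ n)) sums Q w"
      unfolding Q_def by (rule sums_mult)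
    moreover have "rGamma a * rGamma (1 - a) * (1 * Beta (a + of_nat N + of_nat n) (1 - a) * w ^ n) =
        pochhammer a (n + N) / fact (n + N) * w ^ n" for n
    proof -
      have a': "rGamma a = pochhammer a (n + N) * rGamma (a + of_nat N + of_nat n)"
        using pochhammer_rGamma[of a "n + N"] by (simp add: add_ac)
      have "rGamma (a + of_nat N + of_nat n) * Gamma (a + of_nat N + of_nat n) = 1"
        using nonpole[of "a + of_nat N + of_nat n"] a by (simp add: Gamma_def rGamma_eq_zero_iff)
      moreover have "rGamma (1 - a) * Gamma (1 - a) = 1"
        using nonpole[OF pq(2)] by (simp add: Gamma_def rGamma_eq_zero_iff)
      moreover have "rGamma (a + of_nat N + of_nat n + (1 - a)) = 1 / fact (n + N)"
        using Gamma_fact[of "n + N", where ?'a = complex]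
        by (simp add: rGamma_inverse_Gamma add_ac divide_inverse)
      moreover have "rGamma a * rGamma (1 - a) * (1 * Beta (a + of_nat N + of_nat n) (1 - a) * w ^ n) =
          pochhammer a (n + N) * (rGamma (a + of_nat N + of_nat n) * Gamma (a + of_nat N + of_nat n)) *
          (rGamma (1 - a) * Gamma (1 - a)) * rGamma (a + of_nat N + of_nat n + (1 - a)) * w ^ n"
        unfolding a' Beta_altdef by (simp only: mult_ac mult_1_left)
      ultimately show ?thesis by simp
    qed
    ultimately show ?thesis by simp
  qed
  have M: "norm (Q (of_real t * z)) \<le>
      norm (sin (complex_of_real pi * a)) / pi * (D * Beta (Re a + real N) (1 - Re a))"
    if t: "t \<in> {0<..<1}" for t
  proof -
    have "norm (?B (of_real t * z)) \<le> D * Beta (Re (a + of_nat N)) (Re (1 - a))"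
    proof (rule norm_beta_transform_le[OF pq hol])
      show "of_real t * z \<in> slit_plane" using t by (intro slit_plane_scale z) auto
      fix s :: real assume s: "s \<in> {0<..<1}"
      \<comment> \<open>The two integration variables combine to \<open>s * t\<close>, again in the
        unit interval, so the bound for the segment to \<open>z\<close> serves every
        \<open>t\<close>.\<close>
      have "norm (1 / (1 - of_real (s * t) * z)) \<le> D"
        unfolding D_def by (rule norm_inverse_one_minus_scaled_le) (use s t z in \<open>auto intro: mult_le_one\<close>)
      thus "norm (1 / (1 - of_real s * (of_real t * z))) \<le> D" by (simp add: mult.assoc)
    qed
    thus ?thesis
      unfolding Q_def rGamma_reflection_complex norm_mult norm_divide
      by (intro mult_mono) auto
  qed
  have pos: "Gamma (Re b + real N) > 0" "Gamma (Re c + real N) > 0" "Gamma (Re c - Re b) > 0"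
     "Gamma (Re a + real N) > 0" "Gamma (1 - Re a) > 0"
    using a b cb by auto
  have Beta1: "Beta (Re b + real N) (Re c - Re b) =
      Gamma (Re b + real N) * Gamma (Re c - Re b) / Gamma (Re c + real N)"
    by (simp add: Beta_def add_ac)
  have Beta2: "Beta (Re a + real N) (1 - Re a) = Gamma (Re a + real N) * Gamma (1 - Re a) / fact N"
    using Gamma_fact[of N, where ?'a = real] by (simp add: Beta_def add_ac)
  have "norm (hyp2F1_remainder N z a b c) \<le> norm (Gamma c * rGamma b * rGamma (c - b)) * norm z ^ N *
      (norm (sin (complex_of_real pi * a)) / pi * (D * Beta (Re a + real N) (1 - Re a))) *
      Beta (Re b + real N) (Re c - Re b)"
    by (rule norm_hyp2F1_remainder_le[OF b cb c Q_hol Q_sums z M])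
  \<comment> \<open>At a pole \<open>Gamma b\<close> is \<open>0\<close> and division by it gives
    \<open>0\<close>, in agreement with \<open>rGamma b = 0\<close>.\<close>
  also have "\<dots> = norm (sin (complex_of_real pi * a) * complex_of_real (pochhammer_over_sin (Re a) N))
          * norm (complex_of_real (Gamma_pochhammer (Re b) N) * Gamma c
                    * complex_of_real (Gamma (Re c - Re b))
                  / (Gamma b * complex_of_real (Gamma_pochhammer (Re c) N) * Gamma (c - b)))
          * norm (z ^ N / fact N) * D"
    unfolding Beta1 Beta2 Gamma_pochhammer_eq rGamma_inverse_Gamma norm_mult norm_divide norm_inverse norm_power
    using pos a by (simp add: pochhammer_over_sin_eq norm_mult norm_divide divide_inverse norm_inverse mult_ac)
  finally show ?thesis unfolding D_def .
qed

section \<open>The sign of the remainder for real parameters\<close>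

lemma integral_pos_Ioo:
  fixes g :: "real \<Rightarrow> real"
  assumes "g integrable_on {0<..<1}" "continuous_on {0<..<1} g" "\<And>t. t \<in> {0<..<1} \<Longrightarrow> g t > 0"
  shows "integral {0<..<1} g > 0"
proof -
  \<comment> \<open>The integrand may be unbounded near the ends, so strict positivity is drawn from
    a compact middle interval; the rest contributes nothing negative.\<close>
  have cont: "continuous_on {1/3..2/3} g"
    by (rule continuous_on_subset[OF assms(2)]) auto
  have "integral {1/3..2/3::real} (\<lambda>_. 0) < integral {1/3..2/3} g"
    by (rule integral_less_real) (use assms(3) cont in \<open>auto intro!: continuous_intros\<close>)
  also have "\<dots> \<le> integral {0<..<1} g"
    using assms by (intro integral_subset_le integrable_continuous_real cont) (auto intro: less_imp_le)
  finally show ?thesis by simp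
qed

text \<open>On the segment \<open>Q\<close> has the sign of \<open>pochhammer \<alpha> N\<close> and
  the kernel is positive, so the integral \<open>J\<close> has that sign too. The prefactor
  contributes the sign of
  \<open>pochhammer \<beta> N / pochhammer \<gamma> N * x ^ N\<close>.\<close>

lemma hyp2F1_remainder_sign:
  fixes N :: nat and \<alpha> \<beta> \<gamma> x :: real
  assumes b: "\<beta> + real N > 0" and cb: "\<gamma> > \<beta>" and c: "\<gamma> \<notin> \<int>\<^sub>\<le>\<^sub>0" and x: "x < 0"
  shows "\<exists>y. hyp2F1_remainder N (of_real x) (of_real \<alpha>) (of_real \<beta>) (of_real \<gamma>) = of_real y \<and>
           sgn y = sgn (pochhammer \<alpha> N * pochhammer \<beta> N / (pochhammer \<gamma> N * fact N) * x ^ N)"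
proof -
  obtain Q where Q: "Q holomorphic_on slit_plane"
    "\<And>w. norm w < 1 \<Longrightarrow> (\<lambda>n. pochhammer (of_real \<alpha>) (n + N) / fact (n + N) * w ^ n) sums Q w"
    "\<And>w. w \<in> slit_plane \<Longrightarrow>
       w ^ N * Q w = (1 - w) powr (- of_real \<alpha>) - (\<Sum>n<N. pochhammer (of_real \<alpha>) n / fact n * w ^ n)"
    using binomial_quotient_exists by blast
  have slit: "of_real x \<in> slit_plane" using x by (auto simp: slit_plane_def)
  have "\<exists>\<theta>>0. Q (of_real t * of_real x) = of_real (pochhammer \<alpha> N / fact N * \<theta>)" if t: "t \<in> {0<..<1}" for t
  proof -
    let ?w = "t * x"
    have w: "?w < 0" using t x by (simp add: mult_pos_neg)
    obtain \<theta> where \<theta>: "\<theta> > 0" "(1 - ?w) powr (- \<alpha>) - (\<Sum>n<N. pochhammer \<alpha> n / fact n * ?w ^ n) =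
        pochhammer \<alpha> N / fact N * ?w ^ N * \<theta>"
      using binomial_remainder_sign[OF w] by blast
    have "complex_of_real ?w \<in> slit_plane"
      using w unfolding slit_plane_def by (metis ComplI atLeast_iff imageE not_le of_real_eq_iff order_less_trans zero_less_one)
    hence "of_real ?w ^ N * Q (of_real ?w) =
        of_real (1 - ?w) powr of_real (- \<alpha>) - (\<Sum>n<N. pochhammer (of_real \<alpha>) n / fact n * of_real ?w ^ n)"
      using Q(3)[of "of_real ?w"] by simp
    also have "\<dots> = of_real ((1 - ?w) powr (- \<alpha>) - (\<Sum>n<N. pochhammer \<alpha> n / fact n * ?w ^ n))"
      using w by (subst powr_of_real) (auto simp: of_real_pochhammer)
    also have "\<dots> = of_real ?w ^ N * of_real (pochhammer \<alpha> N / fact N * \<theta>)"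
      unfolding \<theta>(2) by simp
    finally have "Q (of_real ?w) = of_real (pochhammer \<alpha> N / fact N * \<theta>)"
      using w by (subst (asm) mult_left_cancel) auto
    thus ?thesis using \<theta>(1) by auto
  qed
  then obtain \<theta> where \<theta>: "\<And>t. t \<in> {0<..<1} \<Longrightarrow> \<theta> t > 0"
    "\<And>t. t \<in> {0<..<1} \<Longrightarrow> Q (of_real t * of_real x) = of_real (pochhammer \<alpha> N / fact N * \<theta> t)"
    by metis
  let ?p = "\<beta> + real N" and ?q = "\<gamma> - \<beta>"
  define k where "k t = t powr (?p - 1) * (1 - t) powr (?q - 1)" for t
  define h where "h t = beta_kernel (of_real ?p) (of_real ?q) t * Q (of_real t * of_real x)" for t
  have h: "h t = of_real (pochhammer \<alpha> N / fact N * (k t * \<theta> t))" if "t \<in> {0<..<1}" for t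
    unfolding h_def k_def beta_kernel_of_real[OF that] \<theta>(2)[OF that] by simp
  have h_int: "h integrable_on {0<..<1}"
    unfolding h_def using b cb by (intro beta_transform_integrable Q slit) auto
  have h_cont: "continuous_on {0<..<1} h"
    unfolding h_def
    by (intro continuous_intros continuous_on_beta_kernel
          continuous_on_subset[OF continuous_on_dilation[OF Q(1) slit]]) auto
  define J where "J = integral {0<..<1} (\<lambda>t. Re (h t))"
  have Re_int: "(\<lambda>t. Re (h t)) integrable_on {0<..<1}"
    using integrable_linear[OF h_int bounded_linear_Re] by (simp add: o_def)
  have "((\<lambda>t. of_real (Re (h t))) has_integral complex_of_real J) {0<..<1}"
    unfolding J_def by (intro has_integral_of_real integrable_integral Re_int)
  also have "?this \<longleftrightarrow> (h has_integral of_real J) {0<..<1}"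
    by (intro has_integral_cong) (simp only: h Re_complex_of_real)
  finally have transform: "beta_transform (of_real \<beta> + of_nat N) (of_real \<gamma> - of_real \<beta>) Q (of_real x) = of_real J"
    unfolding beta_transform_def h_def by (simp add: integral_unique)
  have sgn_J: "sgn J = sgn (pochhammer \<alpha> N)"
  proof (cases "pochhammer \<alpha> N = 0")
    case True
    have "J = integral {0<..<1} (\<lambda>t::real. 0::real)"
      unfolding J_def by (intro integral_cong) (simp add: h True)
    thus ?thesis using True by simp
  next
    case False
    have "0 < integral {0<..<1} (\<lambda>t. sgn (pochhammer \<alpha> N) * Re (h t))"
    proof (rule integral_pos_Ioo)
      show "(\<lambda>t. sgn (pochhammer \<alpha> N) * Re (h t)) integrable_on {0<..<1}"
        using Re_int by (intro integrable_on_mult_right)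
      show "continuous_on {0<..<1} (\<lambda>t. sgn (pochhammer \<alpha> N) * Re (h t))"
        by (intro continuous_intros h_cont)
      fix t :: real assume t: "t \<in> {0<..<1}"
      have "sgn (pochhammer \<alpha> N) * Re (h t) = \<bar>pochhammer \<alpha> N\<bar> / fact N * (k t * \<theta> t)"
        unfolding h[OF t] Re_complex_of_real by (simp add: abs_sgn[of "pochhammer \<alpha> N"])
      also have "\<dots> > 0"
        using False t \<theta>(1)[OF t] by (auto simp: k_def)
      finally show "0 < sgn (pochhammer \<alpha> N) * Re (h t)" .
    qed
    hence "sgn (pochhammer \<alpha> N) * J > 0" by (simp add: J_def)
    thus ?thesis using False by (auto simp: sgn_real_def split: if_splits)
  qed
  define y where "y = Gamma \<gamma> * rGamma \<beta> * rGamma (\<gamma> - \<beta>) * x ^ N * J"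
  have "hyp2F1_remainder N (of_real x) (of_real \<alpha>) (of_real \<beta>) (of_real \<gamma>) = of_real y"
  proof -
    have "complex_of_real \<gamma> \<notin> \<int>\<^sub>\<le>\<^sub>0" using c by (simp add: of_real_in_nonpos_Ints_iff)
    thus ?thesis
      using hyp2F1_remainder_eq_beta_transform[of "of_real \<beta>" N "of_real \<gamma>" Q "of_real \<alpha>" "of_real x"] b cb Q(1,2) slit
      by (simp add: transform y_def Gamma_complex_of_real rGamma_complex_of_real
            rGamma_complex_of_real[of "\<gamma> - \<beta>", simplified])
  qed
  moreover have "sgn y = sgn (pochhammer \<alpha> N * pochhammer \<beta> N / (pochhammer \<gamma> N * fact N) * x ^ N)"
  proof -
    have pos: "Gamma (\<gamma> + real N) > 0" "Gamma (\<beta> + real N) > 0" "Gamma (\<gamma> - \<beta>) > 0"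
      using b cb by auto
    \<comment> \<open>\<open>\<gamma>\<close> and \<open>\<beta>\<close> may be negative, but their
      shifts by \<open>N\<close> are positive, so the signs of \<open>Gamma \<gamma>\<close> and
      \<open>rGamma \<beta>\<close> are carried by the Pochhammer symbols.\<close>
    have "Gamma \<gamma> \<noteq> 0" using c by (simp add: Gamma_eq_zero_iff)
    hence "Gamma \<gamma> = Gamma (\<gamma> + real N) / pochhammer \<gamma> N"
      using pochhammer_Gamma[OF c, of N] pos by simp
    moreover have "rGamma \<beta> = pochhammer \<beta> N / Gamma (\<beta> + real N)"
      using pochhammer_rGamma[of \<beta> N] by (simp add: rGamma_inverse_Gamma divide_inverse)
    ultimately show ?thesis
      using pos unfolding y_def rGamma_inverse_Gamma
      by (simp add: sgn_mult sgn_divide sgn_J sgn_inverse)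
  qed
  ultimately show ?thesis by blast
qed

theorem theorem2p1:
  fixes N :: nat and a b c :: complex
  assumes "real N > max (- Re a) (- Re b)"
    and "Re c > Re b"
    and "c \<notin> \<int>\<^sub>\<le>\<^sub>0"
  shows
    "(\<forall>z. Re z \<le> 0 \<longrightarrow>
        norm (hyp2F1_remainder N z a b c) \<le>
          norm (complex_of_real (Gamma (Re b + real N)) * Gamma (c + of_nat N)
                  * complex_of_real (Gamma (Re c - Re b))
                / (Gamma (b + of_nat N) * complex_of_real (Gamma (Re c + real N))
                  * Gamma (c - b)))
          * norm (hyp2F1_term a b c z N)
          * max 1 (exp (Im a * Arg (- z))))
   \<and> (Re a < 1 \<longrightarrow> (\<forall>z \<in> slit_plane.
        norm (hyp2F1_remainder N z a b c) \<le>
          norm (sin (complex_of_real pi * a) * complex_of_real (pochhammer_over_sin (Re a) N))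
          * norm (complex_of_real (Gamma_pochhammer (Re b) N) * Gamma c
                    * complex_of_real (Gamma (Re c - Re b))
                  / (Gamma b * complex_of_real (Gamma_pochhammer (Re c) N) * Gamma (c - b)))
          * norm (z ^ N / fact N)
          * (if Re z \<le> 0 then 1
             else if Re z \<le> (norm z)\<^sup>2 then norm (z / complex_of_real (Im z))
             else 1 / norm (1 - z))))
   \<and> (\<forall>z. a \<in> \<real> \<and> b \<in> \<real> \<and> c \<in> \<real> \<and> z \<in> \<real> \<and> Re z < 0 \<longrightarrow>
        hyp2F1_remainder N z a b c \<in> \<real>
        \<and> norm (hyp2F1_remainder N z a b c) \<le> norm (hyp2F1_term a b c z N)
        \<and> sgn (Re (hyp2F1_remainder N z a b c)) = sgn (Re (hyp2F1_term a b c z N)))"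
proof (intro conjI allI ballI impI)
  have ab: "Re a + real N > 0" "Re b + real N > 0" using assms(1) by auto
  note left = hyp2F1_remainder_bound_left_half_plane[OF ab assms(2,3)]
  fix z
  show "norm (hyp2F1_remainder N z a b c) \<le>
          norm (complex_of_real (Gamma (Re b + real N)) * Gamma (c + of_nat N)
                  * complex_of_real (Gamma (Re c - Re b))
                / (Gamma (b + of_nat N) * complex_of_real (Gamma (Re c + real N))
                  * Gamma (c - b)))
          * norm (hyp2F1_term a b c z N)
          * max 1 (exp (Im a * Arg (- z)))" if "Re z \<le> 0"
    using that by (rule left)
  show "norm (hyp2F1_remainder N z a b c) \<le>
          norm (sin (complex_of_real pi * a) * complex_of_real (pochhammer_over_sin (Re a) N))
          * norm (complex_of_real (Gamma_pochhammer (Re b) N) * Gamma c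
                    * complex_of_real (Gamma (Re c - Re b))
                  / (Gamma b * complex_of_real (Gamma_pochhammer (Re c) N) * Gamma (c - b)))
          * norm (z ^ N / fact N)
          * (if Re z \<le> 0 then 1
             else if Re z \<le> (norm z)\<^sup>2 then norm (z / complex_of_real (Im z))
             else 1 / norm (1 - z))" if "Re a < 1" "z \<in> slit_plane"
    using hyp2F1_remainder_bound_slit_plane[OF ab(1) that(1) ab(2) assms(2,3) that(2)] .
  assume R: "a \<in> \<real> \<and> b \<in> \<real> \<and> c \<in> \<real> \<and> z \<in> \<real> \<and> Re z < 0"
  define \<alpha> \<beta> \<gamma> x where "\<alpha> = Re a" and "\<beta> = Re b" and "\<gamma> = Re c" and "x = Re z"
  have eqs: "a = of_real \<alpha>" "b = of_real \<beta>" "c = of_real \<gamma>" "z = of_real x"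
    using R by (auto simp: \<alpha>_def \<beta>_def \<gamma>_def x_def)
  have sides: "\<beta> + real N > 0" "\<gamma> > \<beta>" "\<gamma> \<notin> \<int>\<^sub>\<le>\<^sub>0" "x < 0"
    using ab assms R by (auto simp: eqs of_real_in_nonpos_Ints_iff)
  obtain y where y: "hyp2F1_remainder N z a b c = of_real y"
    "sgn y = sgn (pochhammer \<alpha> N * pochhammer \<beta> N / (pochhammer \<gamma> N * fact N) * x ^ N)"
    using hyp2F1_remainder_sign[OF sides, of \<alpha>] unfolding eqs by blast
  have tm: "hyp2F1_term a b c z N =
      of_real (pochhammer \<alpha> N * pochhammer \<beta> N / (pochhammer \<gamma> N * fact N) * x ^ N)"
    by (simp add: hyp2F1_term_def eqs of_real_pochhammer)
  show "hyp2F1_remainder N z a b c \<in> \<real>" by (simp add: y)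
  show "sgn (Re (hyp2F1_remainder N z a b c)) = sgn (Re (hyp2F1_term a b c z N))"
    unfolding y(1) tm Re_complex_of_real y(2) ..
  have "Gamma (\<beta> + real N) \<noteq> 0" "Gamma (\<gamma> + real N) \<noteq> 0" "Gamma (\<gamma> - \<beta>) \<noteq> 0"
    using sides Gamma_real_pos[of "\<beta> + real N"] Gamma_real_pos[of "\<gamma> + real N"]
      Gamma_real_pos[of "\<gamma> - \<beta>"] by linarith+
  moreover have "Gamma (c + of_nat N) = of_real (Gamma (\<gamma> + real N))"
    "Gamma (b + of_nat N) = of_real (Gamma (\<beta> + real N))" "Gamma (c - b) = of_real (Gamma (\<gamma> - \<beta>))"
    using Gamma_complex_of_real[of "\<gamma> + real N"] Gamma_complex_of_real[of "\<beta> + real N"]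
      Gamma_complex_of_real[of "\<gamma> - \<beta>"] by (simp_all add: eqs)
  \<comment> \<open>For real parameters the Gamma quotient in the left half plane bound cancels to
    \<open>1\<close>, and \<open>Im a = 0\<close> reduces the maximum to \<open>1\<close>.\<close>
  ultimately show "norm (hyp2F1_remainder N z a b c) \<le> norm (hyp2F1_term a b c z N)"
    using left[of z] sides by (simp add: norm_mult norm_divide eqs)
qed

end
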